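(* Let $R_O,R_I,R_C$ be positive reals and let $\Omega\subset\mathbb{C}$ be a domain satisfying the $(R_O,R_I,R_C)$ condition. Then for every conformal map $f$ of the unit disk $\mathbb{D}$ onto $\Omega$ with $f(0)=0$ we have $$\|f'\|_{H^\infty}\le R_C\,e^{2F(R_O,R_I,R_C)}.$$ Moreover, equality is attained whenever $\Omega$ is a disk: if $\Omega=D(b,\rho)$ with $0\le|b|<\rho$, and $R_C=\rho$ (so that $R_O=\rho+|b|$ and $R_I=\rho-|b|$), then equality holds in this inequality.
   Context: Notation: $\mathbb{D}=\{z\in\mathbb{C}:|z|<1\}$, $D(a,r)=\{z\in\mathbb{C}:|z-a|<r\}$, and $\|g\|_{H^\infty}=\sup_{\mathbb{D}}|g|$ for $g$ holomorphic on $\mathbb{D}$. A conformal map of $\mathbb{D}$ onto $\Omega$ is a bijective holomorphic map $\mathbb{D}\to\Omega$. Definition. A simply connected convex domain $\Omega\subset\mathbb{C}$ that contains $0$ and has $C^{1,1}$-smooth boundary (the unit speed parameterization of the boundary has Lipschitz continuous derivative) satisfies the $(R_O,R_I,R_C)$ condition if: $R_O,R_I,R_C$ are all positive; $R_O$ is the minimal $r$ such that $\Omega\subset D(0,r)$; $R_I$ is the maximal $r$ such that $D(0,r)\subset\Omega$; and $\Omega$ can be expressed as a union of open disks of radius $R_C$. Definition of $F$. Let $R=\max(R_C,R_I)$, $r=\min(R_C,R_I)$, $d=R_O-R_C$ and, when $r<R$, $\theta=\arcsin\frac{R-r}{d}$ (for $\Omega$ satisfying the $(R_O,R_I,R_C)$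 condition one always has $R-r\le d$). Then $F(R_O,R_I,R_C)$ equals: - $\dfrac{d}{R}$ if $r=R$; - $\dfrac12\log\dfrac{R+d}{R-d}$ if $r<R$ and $d\le R\tan\frac{\theta}{2}$; - $\dfrac12\left[\cot\frac{\theta}{2}\,\log\left(\frac{R}{r}\cos\theta\right)+\log\dfrac{1+\tan(\theta/2)}{1-\tan(\theta/2)}\right]$ if $r<R$ and $d>R\tan\frac{\theta}{2}$. *)

theory Defs
  imports "HOL-Complex_Analysis.Complex_Analysis"
begin

(* The boundary is a simple closed curve, parameterized with unit speed by an L-periodic
   function on the real line; periodicity makes the derivative match up at the endpoints of
   a period.  Only bounded domains are relevant below, so the boundary is always closed. *)
definition C11_boundary :: "complex set \<Rightarrow> bool" where
  "C11_boundary \<Omega> \<longleftrightarrow>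
     (\<exists>(\<gamma> :: real \<Rightarrow> complex) \<gamma>' L K.
        L > 0 \<and>
        (\<forall>t. \<gamma> (t + L) = \<gamma> t) \<and>
        inj_on \<gamma> {0..<L} \<and>
        range \<gamma> = frontier \<Omega> \<and>
        (\<forall>t. (\<gamma> has_vector_derivative \<gamma>' t) (at t)) \<and>
        (\<forall>t. cmod (\<gamma>' t) = 1) \<and>
        K-lipschitz_on UNIV \<gamma>')"

definition R_condition :: "real \<Rightarrow> real \<Rightarrow> real \<Rightarrow> complex set \<Rightarrow> bool" where
  "R_condition RO RI RC \<Omega> \<longleftrightarrow>
     open \<Omega> \<and> simply_connected \<Omega> \<and> convex \<Omega> \<and> 0 \<in> \<Omega> \<and> C11_boundary \<Omega> \<and>
     RO > 0 \<and> RI > 0 \<and> RC > 0 \<and>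
     (\<Omega> \<subseteq> ball 0 RO \<and> (\<forall>r. \<Omega> \<subseteq> ball 0 r \<longrightarrow> RO \<le> r)) \<and>
     (ball 0 RI \<subseteq> \<Omega> \<and> (\<forall>r. ball 0 r \<subseteq> \<Omega> \<longrightarrow> r \<le> RI)) \<and>
     (\<exists>C. \<Omega> = (\<Union>c\<in>C. ball c RC))"

definition F :: "real \<Rightarrow> real \<Rightarrow> real \<Rightarrow> real" where
  "F RO RI RC =
     (let R = max RC RI; r = min RC RI; d = RO - RC; \<theta> = arcsin ((R - r) / d) in
      if r = R then d / R
      else if d \<le> R * tan (\<theta> / 2) then 1/2 * ln ((R + d) / (R - d))
      else 1/2 * (cot (\<theta> / 2) * ln (R / r * cos \<theta>)
                  + ln ((1 + tan (\<theta> / 2)) / (1 - tan (\<theta> / 2)))))"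

definition conformal_map_onto :: "(complex \<Rightarrow> complex) \<Rightarrow> complex set \<Rightarrow> bool" where
  "conformal_map_onto f \<Omega> \<longleftrightarrow> f holomorphic_on ball 0 1 \<and> bij_betw f (ball 0 1) \<Omega>"

(* Extended-real valued, so that the supremum is meaningful for unbounded functions:
   a finite bound on it includes boundedness. *)
definition Hinf_norm :: "(complex \<Rightarrow> complex) \<Rightarrow> ereal" where
  "Hinf_norm g = (SUP z\<in>ball 0 1. ereal (cmod (g z)))"

end

theory Submission
  imports Defs
begin

text \<open>
The derivative of \<open>f\<close> near the unit circle is governed by hyperbolic distances. For
\<open>w = f z\<close> at distance \<open>\<delta>\<close> from the complement of \<open>\<Omega>\<close>, convexity puts \<open>\<Omega>\<close> inside a half-plane
whose boundary line is at distance \<open>\<delta>\<close> from \<open>w\<close>, and the Schwarz-Pick inequality for the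
half-plane gives \<open>\<bar>f' z\<bar> (1 - \<bar>z\<bar>\<^sup>2) \<le> 2 \<delta>\<close> (\<open>convex_schwarz_pick\<close>). It remains to bound
\<open>1 - \<bar>z\<bar>\<^sup>2\<close> from below, that is, to bound from above the hyperbolic distance in \<open>\<Omega>\<close> from \<open>0\<close> to \<open>w\<close>,
which in the disc is \<open>artanh \<bar>z\<bar>\<close>.

The boundary point nearest to \<open>w\<close> is touched from inside by a disc of radius \<open>RC\<close> contained in
\<open>\<Omega>\<close>. Its centre \<open>c\<close> lies on the normal through \<open>w\<close>, so that \<open>\<bar>w - c\<bar> = RC - \<delta>\<close>, and Schwarz-Pick
on that disc bounds the distance from \<open>c\<close> to \<open>w\<close> by \<open>artanh (1 - \<delta> / RC)\<close>. If the distance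
from \<open>0\<close> to \<open>c\<close> is at most \<open>F\<close>, the two estimates combine to
\<open>\<bar>f' z\<bar> \<le> RC exp (2 F) \<cdot> 2 / (2 - \<delta> / RC)\<close> (\<open>deriv_le_of_touching_disc\<close>). As \<open>\<bar>z\<bar>\<close> tends to \<open>1\<close>, \<open>\<delta>\<close>
tends to \<open>0\<close>, and the maximum modulus principle yields the theorem.

The number \<open>F\<close> is exactly what one gets by integrating an upper bound for the hyperbolic density along
the segment from \<open>0\<close> to \<open>c\<close>, with the length of the segment replaced by its upper bound \<open>RO - RC\<close>
(\<open>artanh_norm_le_F\<close>). By convexity \<open>\<Omega>\<close> contains the hull of the disc of radius \<open>RI\<close>
about \<open>0\<close> and the disc of radius \<open>RC\<close> about \<open>c\<close>, hence a disc around each point of the segment, with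
radius interpolating linearly. At each point the density is estimated by means of the disc of this
family that gives the smallest value: when the radii agree, the disc centred at the point; otherwise
the largest disc, as long as the point is within \<open>R tan (\<theta> / 2)\<close> of its centre, and from then on the
disc for which the ratio of the distance from its centre to its radius is \<open>tan (\<theta> / 2)\<close>.

For a disc, every step that loses something in general is an equality in the limit along
the diameter through \<open>0\<close>. The lower bound comes from Schwarz-Pick applied to \<open>f\<close> and to its inverse
(\<open>deriv_conformal_map_disc_ge\<close>).
\<close>

section \<open>Schwarz-Pick inequalities\<close>

text \<open>The two forms of the Schwarz-Pick inequality, for pairs of points and for derivatives, are the two
conclusions of the Schwarz lemma applied to \<open>\<phi>\<close> conjugated by the disc automorphisms that move \<open>y\<close>
and \<open>\<phi> y\<close> to the origin. \<open>Moebius_function 0 y x\<close> has modulus \<open>tanh\<close> of the hyperbolic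
distance from \<open>x\<close> to \<open>y\<close>, in the normalization where \<open>artanh \<bar>x\<bar>\<close> is the distance from \<open>0\<close>.\<close>

lemma schwarz_pick_unit:
  assumes hol: "\<phi> holomorphic_on ball 0 1" and im: "\<phi> ` ball 0 1 \<subseteq> ball 0 1"
    and y: "cmod y < 1"
  shows "cmod x < 1 \<Longrightarrow>
           cmod (Moebius_function 0 (\<phi> y) (\<phi> x)) \<le> cmod (Moebius_function 0 y x)"
    and "cmod (deriv \<phi> y) * (1 - (cmod y)\<^sup>2) \<le> 1 - (cmod (\<phi> y))\<^sup>2"
proof -
  have lt: "cmod (\<phi> z) < 1" if "cmod z < 1" for z
    using im that by (auto simp: image_subset_iff)
  define N where "N = Moebius_function 0 (-y)"
  define M where "M = Moebius_function 0 (\<phi> y)"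
  define \<psi> where "\<psi> = M \<circ> \<phi> \<circ> N"
  have Nlt: "cmod (N z) < 1" if "cmod z < 1" for z
    unfolding N_def using y that by (intro Moebius_function_norm_lt_1) auto
  have Mlt: "cmod (M z) < 1" if "cmod z < 1" for z
    unfolding M_def using lt[OF y] that by (intro Moebius_function_norm_lt_1) auto
  have holN: "N holomorphic_on ball 0 1"
    unfolding N_def using y by (intro Moebius_function_holomorphic) auto
  have holM: "M holomorphic_on ball 0 1"
    unfolding M_def using lt[OF y] by (intro Moebius_function_holomorphic) auto
  have N0: "N 0 = y"
    by (simp add: N_def Moebius_function_of_zero)
  have hol\<psi>: "\<psi> holomorphic_on ball 0 1"
    unfolding \<psi>_def
    using hol holM holN lt Nlt
    by (intro holomorphic_on_compose_gen[where t = "ball 0 1"]) auto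
  have \<psi>0: "\<psi> 0 = 0"
    by (simp add: \<psi>_def N0 M_def Moebius_function_eq_zero)
  have \<psi>lt: "cmod (\<psi> z) < 1" if "cmod z < 1" for z
    using that by (simp add: \<psi>_def Mlt lt Nlt)
  show "cmod (Moebius_function 0 (\<phi> y) (\<phi> x)) \<le> cmod (Moebius_function 0 y x)"
    if x: "cmod x < 1"
  proof -
    have "N (Moebius_function 0 y x) = x"
      unfolding N_def using y x by (intro Moebius_function_compose) auto
    moreover have "cmod (\<psi> (Moebius_function 0 y x)) \<le> cmod (Moebius_function 0 y x)"
      using Schwarz_Lemma(1)[OF hol\<psi> \<psi>0 \<psi>lt Moebius_function_norm_lt_1[OF y x, of 0]] by blast
    ultimately show ?thesis
      by (simp add: \<psi>_def M_def)
  qed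
  have nz: "1 - (cmod w)\<^sup>2 > 0" if "cmod w < 1" for w
    using that by (simp add: power_less_one_iff abs_square_less_1)
  have nz': "1 - cnj w * w = of_real (1 - (cmod w)\<^sup>2)" for w
    by (metis complex_norm_square mult.commute of_real_1 of_real_diff)
  have dN: "(N has_field_derivative of_real (1 - (cmod y)\<^sup>2)) (at 0)"
    unfolding N_def Moebius_function_def
    by (rule derivative_eq_intros refl | simp add: complex_norm_square[symmetric] mult.commute)+
  have dM: "(M has_field_derivative 1 / of_real (1 - (cmod (\<phi> y))\<^sup>2)) (at (\<phi> y))"
  proof -
    have ne: "1 - cnj (\<phi> y) * \<phi> y \<noteq> 0"
      using nz[OF lt[OF y]] unfolding nz' of_real_eq_0_iff by linarith
    show ?thesis
      unfolding M_def Moebius_function_def nz'[symmetric]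
      by (rule derivative_eq_intros refl ne | use ne in \<open>simp add: divide_simps\<close>)+
  qed
  have d\<phi>: "(\<phi> has_field_derivative deriv \<phi> y) (at y)"
    using hol y by (intro holomorphic_derivI[of _ "ball 0 1"]) auto
  have "(\<psi> has_field_derivative
          1 / of_real (1 - (cmod (\<phi> y))\<^sup>2) * deriv \<phi> y * of_real (1 - (cmod y)\<^sup>2)) (at 0)"
    unfolding \<psi>_def
    by (intro DERIV_chain) (use dM dN d\<phi> N0 in auto)
  then have "deriv \<psi> 0 = 1 / of_real (1 - (cmod (\<phi> y))\<^sup>2) * deriv \<phi> y * of_real (1 - (cmod y)\<^sup>2)"
    by (rule DERIV_imp_deriv)
  then have "cmod (deriv \<psi> 0) =
      cmod (deriv \<phi> y) * (1 - (cmod y)\<^sup>2) / (1 - (cmod (\<phi> y))\<^sup>2)"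
    using nz[OF y] nz[OF lt[OF y]]
    by (simp add: norm_mult norm_divide del: of_real_diff of_real_power)
  moreover have "cmod (deriv \<psi> 0) \<le> 1"
    using Schwarz_Lemma(2)[OF hol\<psi> \<psi>0 \<psi>lt, of 0] by simp
  ultimately show "cmod (deriv \<phi> y) * (1 - (cmod y)\<^sup>2) \<le> 1 - (cmod (\<phi> y))\<^sup>2"
    using nz[OF lt[OF y]] by (simp add: pos_divide_le_eq)
qed

lemma schwarz_pick_disc:
  assumes hol: "G holomorphic_on ball a \<rho>" and im: "G ` ball a \<rho> \<subseteq> ball 0 1"
    and w: "cmod (w - a) < \<rho>"
  shows "cmod (Moebius_function 0 (G a) (G w)) \<le> cmod (w - a) / \<rho>"
    and "cmod (deriv G w) * (\<rho>\<^sup>2 - (cmod (w - a))\<^sup>2) \<le> \<rho> * (1 - (cmod (G w))\<^sup>2)"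
proof -
  have \<rho>: "\<rho> > 0"
    using w norm_ge_zero[of "w - a"] by linarith
  define T where "T = (\<lambda>z. a + of_real \<rho> * z)"
  have T: "T z \<in> ball a \<rho>" if "cmod z < 1" for z
    using that \<rho> by (simp add: T_def dist_norm norm_mult)
  have hol': "(G \<circ> T) holomorphic_on ball 0 1"
    using T by (intro holomorphic_on_compose_gen[OF _ hol]) (auto simp: T_def intro!: holomorphic_intros)
  have im': "(G \<circ> T) ` ball 0 1 \<subseteq> ball 0 1"
    using T im by fastforce
  define x where "x = (w - a) / of_real \<rho>"
  have x: "cmod x = cmod (w - a) / \<rho>" and x1: "cmod x < 1"
    using w \<rho> by (auto simp: x_def norm_divide)
  have Tx: "T x = w"
    using \<rho> by (simp add: T_def x_def)
  have "cmod (Moebius_function 0 ((G \<circ> T) 0) ((G \<circ> T) x)) \<le> cmod (Moebius_function 0 0 x)"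
    using schwarz_pick_unit(1)[OF hol' im' _ x1, of 0] by simp
  then show "cmod (Moebius_function 0 (G a) (G w)) \<le> cmod (w - a) / \<rho>"
    by (simp add: Tx x) (simp add: T_def Moebius_function_simple x)
  have "(G has_field_derivative deriv G w) (at w)"
    using hol w by (intro holomorphic_derivI[of _ "ball a \<rho>"]) (auto simp: dist_norm norm_minus_commute)
  then have "(G \<circ> T has_field_derivative deriv G w * of_real \<rho>) (at x)"
    unfolding Tx[symmetric]
    by (intro DERIV_chain) (auto simp: T_def intro!: derivative_eq_intros)
  then have "deriv (G \<circ> T) x = deriv G w * of_real \<rho>"
    by (rule DERIV_imp_deriv)
  then have "cmod (deriv G w) * \<rho> * (1 - (cmod (w - a) / \<rho>)\<^sup>2) \<le> 1 - (cmod (G w))\<^sup>2"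
    using schwarz_pick_unit(2)[OF hol' im' x1] \<rho> by (simp add: norm_mult x Tx)
  then have "\<rho> * (cmod (deriv G w) * \<rho> * (1 - (cmod (w - a) / \<rho>)\<^sup>2)) \<le> \<rho> * (1 - (cmod (G w))\<^sup>2)"
    using \<rho> by (intro mult_left_mono) auto
  also have "\<rho> * (cmod (deriv G w) * \<rho> * (1 - (cmod (w - a) / \<rho>)\<^sup>2)) =
      cmod (deriv G w) * (\<rho>\<^sup>2 - (cmod (w - a))\<^sup>2)"
    using \<rho> by (simp add: field_simps power2_eq_square)
  finally show "cmod (deriv G w) * (\<rho>\<^sup>2 - (cmod (w - a))\<^sup>2) \<le> \<rho> * (1 - (cmod (G w))\<^sup>2)" .
qed

text \<open>The triangle inequality of the hyperbolic metric for the points \<open>0\<close>, \<open>u\<close>, \<open>v\<close>, with the subtraction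
formula of \<open>tanh\<close> cleared of denominators. After squaring, the difference of the two sides is a
multiple of \<open>\<bar>u\<bar> \<bar>v\<bar> - u \<bullet> v\<close>.\<close>

lemma norm_Moebius_ge:
  assumes "cmod u < 1" "cmod v < 1"
  shows "\<bar>cmod u - cmod v\<bar> \<le> cmod (Moebius_function 0 v u) * (1 - cmod u * cmod v)"
proof -
  define m where "m = cmod u * cmod v"
  define c where "c = u \<bullet> v"
  have m1: "m < 1"
    unfolding m_def using assms by (metis mult_strict_mono' norm_ge_zero mult_1)
  have cm: "c \<le> m"
    unfolding c_def m_def by (rule norm_cauchy_schwarz)
  have e1: "(cmod (u - v))\<^sup>2 = (cmod u)\<^sup>2 + (cmod v)\<^sup>2 - 2 * c"
    by (simp add: c_def power2_norm_eq_inner inner_diff inner_commute)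
  have e2: "(cmod (1 - cnj v * u))\<^sup>2 = 1 - 2 * c + m\<^sup>2"
    unfolding c_def m_def power_mult_distrib cmod_power2 
    by (simp add: inner_complex_def power2_eq_square algebra_simps)
  have pos: "0 < cmod (1 - cnj v * u)"
  proof -
    have "cmod (cnj v * u) < 1"
      using m1 by (simp add: m_def norm_mult mult.commute)
    then show ?thesis by auto
  qed
  have "(cmod (u - v) * (1 - m))\<^sup>2 - ((cmod u - cmod v) * cmod (1 - cnj v * u))\<^sup>2 =
     2 * (m - c) * ((1 - (cmod u)\<^sup>2) * (1 - (cmod v)\<^sup>2))"
    unfolding power_mult_distrib e1 e2 m_def by (simp add: power2_eq_square algebra_simps)
  also have "\<dots> \<ge> 0"
    using cm assms by (intro mult_nonneg_nonneg) (auto simp: abs_square_le_1)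
  finally have "((cmod u - cmod v) * cmod (1 - cnj v * u))\<^sup>2 \<le> (cmod (u - v) * (1 - m))\<^sup>2"
    by simp
  then have "\<bar>(cmod u - cmod v) * cmod (1 - cnj v * u)\<bar> \<le> \<bar>cmod (u - v) * (1 - m)\<bar>"
    by (rule power2_le_iff_abs_le[THEN iffD1, rotated, of _ "\<bar>_\<bar>", simplified])
  then have "\<bar>cmod u - cmod v\<bar> * cmod (1 - cnj v * u) \<le> cmod (u - v) * (1 - m)"
    using m1 by (simp add: abs_mult)
  then have "\<bar>cmod u - cmod v\<bar> \<le> cmod (u - v) * (1 - m) / cmod (1 - cnj v * u)"
    using pos by (simp add: pos_le_divide_eq)
  then show ?thesis
    by (simp add: Moebius_function_simple norm_divide m_def)
qed

section \<open>Hyperbolic distance between the centres of two discs in a convex domain\<close>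

lemma artanh_mono:
  fixes x y :: real
  assumes "0 \<le> x" "x \<le> y" "y < 1"
  shows "artanh x \<le> artanh y"
  unfolding artanh_def using assms by (auto intro!: divide_right_mono ln_mono frac_le)

text \<open>The point \<open>A + t (B - A) + \<rho> u\<close> of the interpolating ball is the convex combination, with weights
\<open>1 - t\<close> and \<open>t\<close>, of the points \<open>A + R u\<close> and \<open>B + r u\<close> in the same direction.\<close>

lemma ball_on_segment_subset:
  fixes A B :: "'a :: real_normed_vector"
  assumes conv: "convex \<Omega>" and balls: "ball A R \<subseteq> \<Omega>" "ball B r \<subseteq> \<Omega>"
    and "0 < R" "0 < r" and t: "0 \<le> t" "t \<le> 1"
  shows "ball (A + t *\<^sub>R (B - A)) (R - t * (R - r)) \<subseteq> \<Omega>"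
proof
  fix x assume x: "x \<in> ball (A + t *\<^sub>R (B - A)) (R - t * (R - r))"
  define \<rho> where "\<rho> = R - t * (R - r)"
  define u where "u = (x - (A + t *\<^sub>R (B - A))) /\<^sub>R \<rho>"
  have "\<rho> > 0"
    using x unfolding \<rho>_def by (metis dist_commute dual_order.strict_trans2 mem_ball zero_le_dist)
  then have u: "norm u < 1" and xu: "x = A + t *\<^sub>R (B - A) + \<rho> *\<^sub>R u"
    using x by (auto simp: u_def \<rho>_def dist_norm norm_minus_commute divide_simps)
  have "A + R *\<^sub>R u \<in> \<Omega>" "B + r *\<^sub>R u \<in> \<Omega>"
    using balls u \<open>0 < R\<close> \<open>0 < r\<close> by (auto simp: dist_norm subset_iff)
  then have "(1 - t) *\<^sub>R (A + R *\<^sub>R u) + t *\<^sub>R (B + r *\<^sub>R u) \<in> \<Omega>"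
    using conv t by (simp add: convex_alt)
  also have "(1 - t) *\<^sub>R (A + R *\<^sub>R u) + t *\<^sub>R (B + r *\<^sub>R u) = x"
    unfolding xu \<rho>_def by (simp add: algebra_simps)
  finally show "x \<in> \<Omega>" .
qed

text \<open>Integration of a bound \<open>k\<close> on the hyperbolic density pulled back by \<open>G\<close>, with \<open>\<Phi>\<close> a primitive
of \<open>k\<close>. The modulus of \<open>G\<close> is differentiable along the segment because the injective \<open>G\<close>
vanishes only at its starting point. In the degenerate case \<open>A = B\<close> the claim is that \<open>\<Phi>\<close> does not
decrease, which follows from the nonnegativity of \<open>k\<close> that the density bound entails.\<close>

lemma artanh_norm_increment_le:
  assumes "open \<Omega>" and hol: "G holomorphic_on \<Omega>" and im: "G ` \<Omega> \<subseteq> ball 0 1"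
    and inj: "inj_on G \<Omega>" and A: "A \<in> \<Omega>" "G A = 0" and s: "0 \<le> s" "s \<le> 1"
    and seg: "\<And>t. s \<le> t \<Longrightarrow> t \<le> 1 \<Longrightarrow> A + t *\<^sub>R (B - A) \<in> \<Omega>"
    and cont: "continuous_on {s..1} \<Phi>"
    and deriv: "\<And>t. s < t \<Longrightarrow> t < 1 \<Longrightarrow> (\<Phi> has_real_derivative k t) (at t)"
    and bound: "\<And>t. s < t \<Longrightarrow> t < 1 \<Longrightarrow> cmod (deriv G (A + t *\<^sub>R (B - A))) * cmod (B - A)
                    \<le> k t * (1 - (cmod (G (A + t *\<^sub>R (B - A))))\<^sup>2)"
  shows "artanh (cmod (G B)) \<le> artanh (cmod (G (A + s *\<^sub>R (B - A)))) + (\<Phi> 1 - \<Phi> s)"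
proof -
  define \<gamma> where "\<gamma> = (\<lambda>t. A + t *\<^sub>R (B - A))"
  have \<gamma>in: "\<gamma> t \<in> \<Omega>" if "s \<le> t" "t \<le> 1" for t
    using seg that by (simp add: \<gamma>_def)
  have lt1: "cmod (G (\<gamma> t)) < 1" if "s \<le> t" "t \<le> 1" for t
    using im \<gamma>in[OF that] by (auto simp: image_subset_iff)
  have pos: "0 < 1 - (cmod (G (\<gamma> t)))\<^sup>2" if "s \<le> t" "t \<le> 1" for t
    using lt1[OF that] by (simp add: abs_square_less_1)
  show ?thesis
  proof (cases "A = B")
    case True
    have "\<Phi> s \<le> \<Phi> 1"
    proof (rule DERIV_nonneg_imp_increasing_open[OF \<open>s \<le> 1\<close> _ cont])
      fix t assume t: "s < t" "t < 1"
      then have "0 \<le> k t"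
        using bound[OF t] pos[of t] True by (simp add: \<gamma>_def zero_le_mult_iff)
      then show "\<exists>y. (\<Phi> has_real_derivative y) (at t) \<and> 0 \<le> y"
        using deriv[OF t] by blast
    qed
    then show ?thesis
      using True by simp
  next
    case False
    have "artanh (cmod (G (\<gamma> 1))) - \<Phi> 1 \<le> artanh (cmod (G (\<gamma> s))) - \<Phi> s"
    proof (rule DERIV_nonpos_imp_decreasing_open[OF \<open>s \<le> 1\<close>])
      fix t assume t: "s < t" "t < 1"
      have "\<gamma> t \<noteq> A"
        using False t s by (simp add: \<gamma>_def)
      then have nz: "G (\<gamma> t) \<noteq> 0"
        using inj A \<gamma>in[of t] t by (metis inj_onD less_imp_le)
      define D where "D = (B - A) * deriv G (\<gamma> t)"
      have "(\<gamma> has_vector_derivative (B - A)) (at t)"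
        unfolding \<gamma>_def by (auto intro!: derivative_eq_intros)
      moreover have "(G has_field_derivative deriv G (\<gamma> t)) (at (\<gamma> t))"
        using hol \<open>open \<Omega>\<close> \<gamma>in[of t] t by (intro holomorphic_derivI) auto
      ultimately have "((G \<circ> \<gamma>) has_vector_derivative D) (at t)"
        unfolding D_def by (rule field_vector_diff_chain_at)
      then have "((\<lambda>t. norm (G (\<gamma> t))) has_derivative (\<lambda>h. (h *\<^sub>R D) \<bullet> sgn (G (\<gamma> t)))) (at t)"
        unfolding has_vector_derivative_def o_def
        by (rule has_derivative_compose[of "\<lambda>t. G (\<gamma> t)", OF _ has_derivative_norm[OF nz]])
      then have dn: "((\<lambda>t. cmod (G (\<gamma> t))) has_real_derivative (D \<bullet> sgn (G (\<gamma> t)))) (at t)"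
        unfolding has_field_derivative_def by (rule has_derivative_eq_rhs) (auto simp: mult.commute)
      have abs: "\<bar>cmod (G (\<gamma> t))\<bar> < 1"
        using lt1[of t] t by simp
      have "((\<lambda>t. artanh (cmod (G (\<gamma> t)))) has_real_derivative
              1 / (1 - (cmod (G (\<gamma> t)))\<^sup>2) * (D \<bullet> sgn (G (\<gamma> t)))) (at t)"
        by (rule DERIV_chain2[OF artanh_real_has_field_derivative[OF abs] dn])
      then have der: "((\<lambda>t. artanh (cmod (G (\<gamma> t))) - \<Phi> t) has_real_derivative
              1 / (1 - (cmod (G (\<gamma> t)))\<^sup>2) * (D \<bullet> sgn (G (\<gamma> t))) - k t) (at t)"
        by (intro DERIV_diff deriv t)
      have "D \<bullet> sgn (G (\<gamma> t)) \<le> norm D * norm (sgn (G (\<gamma> t)))"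
        by (rule norm_cauchy_schwarz)
      also have "\<dots> = cmod (deriv G (\<gamma> t)) * cmod (B - A)"
        using nz by (simp add: D_def norm_sgn norm_mult mult.commute)
      also have "\<dots> \<le> k t * (1 - (cmod (G (\<gamma> t)))\<^sup>2)"
        using bound[OF t] by (simp add: \<gamma>_def)
      finally have "1 / (1 - (cmod (G (\<gamma> t)))\<^sup>2) * (D \<bullet> sgn (G (\<gamma> t))) - k t \<le> 0"
        using pos[of t] t by (simp add: pos_divide_le_eq)
      then show "\<exists>y. ((\<lambda>t. artanh (cmod (G (\<gamma> t))) - \<Phi> t) has_real_derivative y) (at t) \<and> y \<le> 0"
        using der by blast
    next
      have "continuous_on {s..1} (\<lambda>t. G (\<gamma> t))"
      proof (rule continuous_on_compose2[OF holomorphic_on_imp_continuous_on[OF hol]])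
        show "continuous_on {s..1} \<gamma>"
          unfolding \<gamma>_def by (intro continuous_intros)
      qed (use \<gamma>in in auto)
      then show "continuous_on {s..1} (\<lambda>t. artanh (cmod (G (\<gamma> t))) - \<Phi> t)"
        using lt1 by (intro continuous_intros cont) (auto intro: less_le_trans[OF _ norm_ge_zero])
    qed
    then show ?thesis
      by (simp add: \<gamma>_def)
  qed
qed

text \<open>The density at the point with parameter \<open>t\<close> is estimated by Schwarz-Pick on the interpolating disc with
parameter \<open>t'\<close>. The length of the segment may be replaced by an upper bound \<open>d\<close> because, for
fixed \<open>t\<close> and \<open>t'\<close>, the estimate increases with that length. This is why the final bound can be
stated in terms of \<open>RO - RC\<close> instead of the position of the disc.\<close>

lemma hyperbolic_density_le:
  assumes conv: "convex \<Omega>" and hol: "G holomorphic_on \<Omega>" and im: "G ` \<Omega> \<subseteq> ball 0 1"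
    and balls: "ball A R \<subseteq> \<Omega>" "ball B r \<subseteq> \<Omega>" and pos: "0 < R" "0 < r"
    and d: "cmod (B - A) \<le> d" and t': "0 \<le> t'" "t' \<le> 1"
    and \<rho>: "\<rho> = R - t' * (R - r)" and lt: "\<bar>t - t'\<bar> * d < \<rho>"
  shows "A + t *\<^sub>R (B - A) \<in> \<Omega>"
    and "cmod (deriv G (A + t *\<^sub>R (B - A))) * cmod (B - A) \<le>
           d * \<rho> / (\<rho>\<^sup>2 - ((t - t') * d)\<^sup>2) * (1 - (cmod (G (A + t *\<^sub>R (B - A))))\<^sup>2)"
proof -
  define w where "w = A + t *\<^sub>R (B - A)"
  define a where "a = A + t' *\<^sub>R (B - A)"
  define e where "e = cmod (B - A)"
  have e: "0 \<le> e" "e \<le> d"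
    using d by (auto simp: e_def)
  have sub: "ball a \<rho> \<subseteq> \<Omega>"
    unfolding a_def \<rho> by (rule ball_on_segment_subset) fact+
  have wa: "cmod (w - a) = \<bar>t - t'\<bar> * e"
    unfolding w_def a_def e_def norm_scaleR[symmetric] by (simp add: algebra_simps)
  have le: "\<bar>t - t'\<bar> * e \<le> \<bar>t - t'\<bar> * d"
    using e by (intro mult_left_mono) auto
  have lt': "cmod (w - a) < \<rho>"
    using le lt wa by linarith
  have "0 \<le> \<bar>t - t'\<bar> * d"
    using e by simp
  then have \<rho>0: "\<rho> > 0"
    using lt by linarith
  have wb: "w \<in> ball a \<rho>"
    using lt' by (simp add: dist_norm norm_minus_commute)
  then show "A + t *\<^sub>R (B - A) \<in> \<Omega>"
    using sub by (auto simp: w_def)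
  have g1: "cmod (G w) < 1"
    using im wb sub by (auto simp: image_subset_iff)
  have sq: "(cmod (w - a))\<^sup>2 \<le> ((t - t') * d)\<^sup>2"
    using le e unfolding wa by (intro abs_le_square_iff[THEN iffD1]) (simp add: abs_mult)
  have pos: "0 < \<rho>\<^sup>2 - ((t - t') * d)\<^sup>2"
    using power_strict_mono[OF lt, of 2] e by (simp add: power_mult_distrib)
  have "cmod (deriv G w) * (\<rho>\<^sup>2 - (cmod (w - a))\<^sup>2) \<le> \<rho> * (1 - (cmod (G w))\<^sup>2)"
    using hol im sub lt' by (intro schwarz_pick_disc(2)) (auto intro: holomorphic_on_subset)
  moreover have "cmod (deriv G w) * (\<rho>\<^sup>2 - ((t - t') * d)\<^sup>2) \<le> cmod (deriv G w) * (\<rho>\<^sup>2 - (cmod (w - a))\<^sup>2)"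
    using sq by (intro mult_left_mono) auto
  ultimately have 1: "cmod (deriv G w) * (\<rho>\<^sup>2 - ((t - t') * d)\<^sup>2) \<le> \<rho> * (1 - (cmod (G w))\<^sup>2)"
    by linarith
  have "cmod (deriv G w) \<le> \<rho> * (1 - (cmod (G w))\<^sup>2) / (\<rho>\<^sup>2 - ((t - t') * d)\<^sup>2)"
    using 1 pos by (simp add: pos_le_divide_eq)
  then have "cmod (deriv G w) * e \<le> \<rho> * (1 - (cmod (G w))\<^sup>2) / (\<rho>\<^sup>2 - ((t - t') * d)\<^sup>2) * d"
    using e pos \<rho>0 g1 by (intro mult_mono) (auto simp: abs_square_le_1)
  then show "cmod (deriv G (A + t *\<^sub>R (B - A))) * cmod (B - A) \<le>
           d * \<rho> / (\<rho>\<^sup>2 - ((t - t') * d)\<^sup>2) * (1 - (cmod (G (A + t *\<^sub>R (B - A))))\<^sup>2)"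
    by (simp add: w_def e_def mult_ac)
qed

text \<open>The bound on the hyperbolic distance from \<open>A\<close> to \<open>B\<close>, seen through a map \<open>G\<close> that sends \<open>A\<close> to the
origin, where \<open>A\<close> is the centre of the larger disc. The parameters of \<open>F\<close> are chosen so that its
maximal radius is \<open>R\<close>, its minimal radius is \<open>r\<close> and its length parameter is \<open>d\<close>.\<close>

lemma artanh_norm_le_F:
  assumes conv: "convex \<Omega>" and opn: "open \<Omega>" and hol: "G holomorphic_on \<Omega>"
    and im: "G ` \<Omega> \<subseteq> ball 0 1" and inj: "inj_on G \<Omega>"
    and balls: "ball A R \<subseteq> \<Omega>" "ball B r \<subseteq> \<Omega>" and pos: "0 < r" "r \<le> R"
    and d: "cmod (B - A) \<le> d" "R - r \<le> d" and GA: "G A = 0"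
  shows "artanh (cmod (G B)) \<le> F (R + d) r R"
proof -
  have R0: "0 < R" and d0: "0 \<le> d"
    using pos d norm_ge_zero[of "B - A"] by linarith+
  have A: "A \<in> \<Omega>"
    using balls R0 by auto
  define \<theta> where "\<theta> = arcsin ((R - r) / d)"
  define q where "q = tan (\<theta> / 2)"
  have center: "cmod (G w) \<le> cmod (w - A) / R" if "cmod (w - A) < R" for w
  proof -
    have "cmod (Moebius_function 0 (G A) (G w)) \<le> cmod (w - A) / R"
      using hol im balls that by (intro schwarz_pick_disc(1)) (auto intro: holomorphic_on_subset)
    then show ?thesis
      by (simp add: GA Moebius_function_simple)
  qed
  show ?thesis
  proof (cases "r = R")
    case True
    have dens: "A + t *\<^sub>R (B - A) \<in> \<Omega>"
      "cmod (deriv G (A + t *\<^sub>R (B - A))) * cmod (B - A) \<le>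
           d * R / (R\<^sup>2 - ((t - t) * d)\<^sup>2) * (1 - (cmod (G (A + t *\<^sub>R (B - A))))\<^sup>2)"
      if "0 \<le> t" "t \<le> 1" for t
      by (rule hyperbolic_density_le[OF conv hol im balls R0 pos(1) d(1) that]; use True R0 in simp)+
    have "artanh (cmod (G B)) \<le> artanh (cmod (G (A + 0 *\<^sub>R (B - A)))) + (d / R * 1 - d / R * 0)"
    proof (rule artanh_norm_increment_le[where k = "\<lambda>t. d / R", OF opn hol im inj A GA])
      fix t :: real assume t: "0 < t" "t < 1"
      show "((\<lambda>t. d / R * t) has_real_derivative d / R) (at t)"
        using R0 by (auto intro!: derivative_eq_intros)
      show "cmod (deriv G (A + t *\<^sub>R (B - A))) * cmod (B - A)
          \<le> d / R * (1 - (cmod (G (A + t *\<^sub>R (B - A))))\<^sup>2)"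
        using dens(2)[of t] t R0 by (simp add: power2_eq_square)
    qed (use R0 in \<open>auto simp: dens intro!: continuous_intros\<close>)
    then show ?thesis
      using True GA by (simp add: F_def)
  next
    case False
    then have rR: "0 < R - r" and d_pos: "0 < d"
      using pos d by linarith+
    have frac: "0 < (R - r) / d" "(R - r) / d \<le> 1"
      using rR d_pos d by (auto simp: pos_divide_le_eq)
    have sin\<theta>: "sin \<theta> = (R - r) / d"
      unfolding \<theta>_def using frac by (intro sin_arcsin) linarith+
    have \<theta>: "0 < \<theta>" "\<theta> \<le> pi / 2"
      unfolding \<theta>_def using frac arcsin_less_arcsin[of 0 "(R - r) / d"] arcsin_bounded[of "(R - r) / d"]
      by auto
    show ?thesis
    proof (cases "d \<le> R * q")
      case True
      have dR: "d < R"
      proof (cases "\<theta> = pi / 2")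
        case True
        then have "sin \<theta> = 1"
          by (simp only: sin_pi_half)
        then have "d = R - r"
          using sin\<theta> d_pos by simp
        then show ?thesis using pos by simp
      next
        case False
        then have "q < tan (pi / 4)"
          unfolding q_def using \<theta> by (intro tan_monotone) auto
        then have "R * q < R * 1"
          using R0 by (intro mult_strict_left_mono) (auto simp: tan_45)
        then show ?thesis
          using True by simp
      qed
      have "cmod (G B) \<le> cmod (B - A) / R"
        using d dR by (intro center) auto
      also have "\<dots> \<le> d / R"
        using d R0 by (intro divide_right_mono) auto
      finally have "artanh (cmod (G B)) \<le> artanh (d / R)"
        using dR R0 by (intro artanh_mono) auto
      also have "\<dots> = 1/2 * ln ((R + d) / (R - d))"
      proof -
        have "1 + d / R = (R + d) / R" "1 - d / R = (R - d) / R"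
          using R0 by (simp_all add: add_divide_distrib diff_divide_distrib)
        then show ?thesis
          using R0 by (simp add: artanh_def)
      qed
      also have "\<dots> = F (R + d) r R"
        using True \<open>r \<noteq> R\<close> pos unfolding q_def \<theta>_def by (simp add: F_def Let_def max_absorb1 min_absorb2)
      finally show ?thesis .
    next
      case False
      then have dq: "R * q < d" by simp
      have \<theta>lt: "\<theta> < pi / 2"
      proof (rule ccontr)
        assume "\<not> \<theta> < pi / 2"
        then have eq: "\<theta> = pi / 2"
          using \<theta> by linarith
        have "sin \<theta> = 1" "q = 1"
          unfolding q_def eq by (simp_all add: tan_45)
        then show False
          using sin\<theta> d_pos dq pos by simp
      qed
      define s c where "s = sin (\<theta> / 2)" and "c = cos (\<theta> / 2)"
      have sc1: "s\<^sup>2 + c\<^sup>2 = 1"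
        by (simp add: s_def c_def)
      have c0: "0 < c" and s0: "0 < s"
        unfolding s_def c_def using \<theta> by (auto intro!: cos_gt_zero sin_gt_zero)
      have sin2: "sin \<theta> = 2 * s * c" and cos2: "cos \<theta> = c\<^sup>2 - s\<^sup>2"
        using sin_double[of "\<theta> / 2"] cos_double[of "\<theta> / 2"] by (simp_all add: s_def c_def)
      have q: "q = s / c"
        by (simp add: q_def s_def c_def tan_def)
      have q0: "0 < q"
        using s0 c0 by (simp add: q)
      have cos0: "0 < cos \<theta>"
        using \<theta> \<theta>lt by (intro cos_gt_zero) auto
      have q1: "1 - q\<^sup>2 = cos \<theta> / c\<^sup>2"
        using c0 by (simp add: q cos2 field_simps)
      have q_lt: "q < 1"
        using q1 cos0 c0 q0 by (smt (verit) divide_pos_pos one_le_power zero_less_power)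
      have qs: "q * sin \<theta> = 1 - cos \<theta>"
        using c0 sc1 by (simp add: q sin2 cos2) (simp add: power2_eq_square)
      have Rr: "R - r = d * sin \<theta>"
        using sin\<theta> d_pos by simp
      \<comment> \<open>For \<open>t \<le> t0\<close> the disc about \<open>A\<close> is used, and afterwards the discs with distance-to-radius ratio \<open>q\<close>.\<close>
      define t0 where "t0 = R * q / d"
      have t0: "0 < t0" "t0 < 1" "t0 * d = R * q"
        using R0 q0 d_pos dq by (auto simp: t0_def)
      define \<delta> where "\<delta> = (\<lambda>t. R - t * (R - r))"
      have \<delta>r: "r \<le> \<delta> t" if "t \<le> 1" for t
      proof -
        have "t * (R - r) \<le> 1 * (R - r)"
          using that rR by (intro mult_right_mono) auto
        then show ?thesis by (simp add: \<delta>_def)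
      qed
      then have \<delta>0: "0 < \<delta> t" if "t \<le> 1" for t
        using pos that by (meson less_le_trans)
      have \<delta>t0: "\<delta> t0 = R * cos \<theta>"
      proof -
        have "\<delta> t0 = R - (t0 * d) * sin \<theta>"
          by (simp add: \<delta>_def Rr mult_ac)
        also have "\<dots> = R - R * (q * sin \<theta>)"
          using t0 by simp
        finally show ?thesis
          by (simp add: qs algebra_simps)
      qed
      have dens: "A + t *\<^sub>R (B - A) \<in> \<Omega> \<and> cmod (deriv G (A + t *\<^sub>R (B - A))) * cmod (B - A) \<le>
           d * c\<^sup>2 / \<delta> t * (1 - (cmod (G (A + t *\<^sub>R (B - A))))\<^sup>2)" if t: "t0 \<le> t" "t \<le> 1" for t
      proof -
        \<comment> \<open>The solution of \<open>(t - t') d = q (R - t' (R - r))\<close>, by \<open>1 - q sin \<theta> = cos \<theta>\<close>. Minimizing the density bound over \<open>t'\<close> leads to this equation with \<open>q = tan (\<theta> / 2)\<close>.\<close>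
        define t' where "t' = (t - t0) / cos \<theta>"
        define \<rho> where "\<rho> = R - t' * (R - r)"
        have "cos \<theta> * \<rho> = R * cos \<theta> - (t - t0) * (R - r)"
          using cos0 by (simp add: \<rho>_def t'_def field_simps)
        also have "\<dots> = \<delta> t"
          using \<delta>t0 by (simp add: \<delta>_def algebra_simps)
        finally have \<rho>: "\<rho> = \<delta> t / cos \<theta>"
          using cos0 by (simp add: field_simps)
        then have \<rho>0: "0 < \<rho>"
          using \<delta>0[OF t(2)] cos0 by simp
        have "cos \<theta> * ((t - t') * d) = t0 * d - t * d * (1 - cos \<theta>)"
          using cos0 by (simp add: t'_def field_simps)
        also have "\<dots> = q * \<delta> t"
          unfolding t0 qs[symmetric] \<delta>_def Rr by (simp add: algebra_simps)
        also have "\<dots> = cos \<theta> * (q * \<rho>)"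
          using cos0 by (simp add: \<rho>)
        finally have diff: "(t - t') * d = q * \<rho>"
          using cos0 by simp
        then have tt': "t' \<le> t"
          using q0 \<rho>0 d_pos by (smt (verit) mult_pos_pos zero_less_mult_pos2)
        have t': "0 \<le> t'" "t' \<le> 1"
          using t cos0 tt' by (simp add: t'_def, linarith)
        have lt: "\<bar>t - t'\<bar> * d < \<rho>"
          using diff tt' q_lt \<rho>0 by simp
        have "d * \<rho> / (\<rho>\<^sup>2 - ((t - t') * d)\<^sup>2) = d * \<rho> / (\<rho> * \<rho> * (1 - q\<^sup>2))"
          unfolding diff by (simp add: power2_eq_square algebra_simps)
        also have "\<dots> = d / (\<rho> * (1 - q\<^sup>2))"
          using \<rho>0 by simp
        also have "\<dots> = d * c\<^sup>2 / \<delta> t"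
          unfolding q1 \<rho> using cos0 c0 by simp
        finally have eq: "d * \<rho> / (\<rho>\<^sup>2 - ((t - t') * d)\<^sup>2) = d * c\<^sup>2 / \<delta> t" .
        show ?thesis
          using hyperbolic_density_le[OF conv hol im balls R0 pos(1) d(1) t' \<rho>_def lt] unfolding eq by blast
      qed
      define \<Phi> where "\<Phi> = (\<lambda>t. - (cot (\<theta> / 2) / 2 * ln (\<delta> t)))"
      have coef: "cot (\<theta> / 2) / 2 * (R - r) = d * c\<^sup>2"
        unfolding cot_def Rr sin2 s_def[symmetric] c_def[symmetric] using s0
        by (simp add: power2_eq_square)
      have d\<delta>: "(\<delta> has_real_derivative - (R - r)) (at t)" for t
        unfolding \<delta>_def by (auto intro!: derivative_eq_intros)
      have d\<Phi>: "(\<Phi> has_real_derivative d * c\<^sup>2 / \<delta> t) (at t)" if "t \<le> 1" for t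
        unfolding \<Phi>_def coef[symmetric]
        by (rule derivative_eq_intros d\<delta> refl \<delta>0[OF that])+ (simp add: divide_simps, simp add: algebra_simps)
      have "artanh (cmod (G B)) \<le> artanh (cmod (G (A + t0 *\<^sub>R (B - A)))) + (\<Phi> 1 - \<Phi> t0)"
      proof (rule artanh_norm_increment_le[where k = "\<lambda>t. d * c\<^sup>2 / \<delta> t", OF opn hol im inj A GA])
        show "continuous_on {t0..1} \<Phi>"
          using d\<Phi> by (meson DERIV_continuous_on atLeastAtMost_iff has_field_derivative_at_within)
      qed (use t0 dens d\<Phi> in auto)
      also have "\<Phi> 1 - \<Phi> t0 = cot (\<theta> / 2) / 2 * (ln (\<delta> t0) - ln (\<delta> 1))"
        by (simp add: \<Phi>_def algebra_simps)
      also have "ln (\<delta> t0) - ln (\<delta> 1) = ln (R / r * cos \<theta>)"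
        unfolding \<delta>t0 using R0 cos0 pos by (simp add: \<delta>_def ln_div ln_mult)
      also have "artanh (cmod (G (A + t0 *\<^sub>R (B - A)))) \<le> artanh q"
      proof (rule artanh_mono)
        have "t0 * cmod (B - A) \<le> t0 * d"
          using t0 d by (intro mult_left_mono) auto
        then have le: "cmod (A + t0 *\<^sub>R (B - A) - A) \<le> R * q"
          using t0 by simp
        also have "R * q < R * 1"
          using R0 q_lt by (intro mult_strict_left_mono) auto
        finally have "cmod (G (A + t0 *\<^sub>R (B - A))) \<le> cmod (A + t0 *\<^sub>R (B - A) - A) / R"
          by (intro center) simp
        also have "\<dots> \<le> R * q / R"
          using le R0 by (intro divide_right_mono) auto
        finally show "cmod (G (A + t0 *\<^sub>R (B - A))) \<le> q"
          using R0 by simp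
      qed (use q_lt in auto)
      also have "artanh q + cot (\<theta> / 2) / 2 * ln (R / r * cos \<theta>) = F (R + d) r R"
        using \<open>r \<noteq> R\<close> False pos unfolding artanh_def q_def \<theta>_def
        by (simp add: F_def Let_def max_absorb1 min_absorb2 distrib_left)
      finally show ?thesis by simp
    qed
  qed
qed

section \<open>Supporting hyperplanes and touching balls\<close>

lemma ball_below_hyperplane:
  fixes c n :: "'a :: euclidean_space"
  assumes "ball c \<rho> \<subseteq> {x. x \<bullet> n \<le> k}" and "norm n = 1" "0 < \<rho>"
  shows "c \<bullet> n + \<rho> \<le> k"
proof (rule dense_le_bounded[of "c \<bullet> n"])
  fix y assume y: "c \<bullet> n < y" "y < c \<bullet> n + \<rho>"
  have "c + (y - c \<bullet> n) *\<^sub>R n \<in> ball c \<rho>"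
    using y assms(2) by (simp add: dist_norm)
  then have "(c + (y - c \<bullet> n) *\<^sub>R n) \<bullet> n \<le> k"
    using assms(1) by blast
  then show "y \<le> k"
    using assms(2) by (simp add: inner_add_left dot_square_norm)
qed (use assms in auto)

text \<open>The equality case of Cauchy-Schwarz. It places the centre of a ball touching a supporting
hyperplane from inside on the normal through the point of contact.\<close>

lemma eq_scaleR_normal:
  fixes v n :: "'a :: real_inner"
  assumes "norm v \<le> \<delta>" "\<delta> \<le> v \<bullet> n" "norm n = 1" "0 \<le> \<delta>"
  shows "v = \<delta> *\<^sub>R n"
proof -
  have "(norm (v - \<delta> *\<^sub>R n))\<^sup>2 = (norm v)\<^sup>2 - 2 * (\<delta> * (v \<bullet> n)) + \<delta> * \<delta>"
  proof -
    have "n \<bullet> n = 1"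
      using assms(3) by (simp add: dot_square_norm)
    then show ?thesis
      by (simp add: power2_norm_eq_inner inner_diff inner_commute[of n v] algebra_simps)
  qed
  moreover have "(norm v)\<^sup>2 \<le> \<delta>\<^sup>2"
    using assms by (intro power_mono) auto
  moreover have "\<delta> * \<delta> \<le> \<delta> * (v \<bullet> n)"
    using assms by (intro mult_left_mono) auto
  ultimately have "(norm (v - \<delta> *\<^sub>R n))\<^sup>2 \<le> 0"
    by (simp add: power2_eq_square)
  then show ?thesis by simp
qed

text \<open>A hyperplane supporting \<open>\<Omega>\<close> at the point of the complement nearest to \<open>w\<close> also supports the ball of radius
\<open>\<delta>\<close> about \<open>w\<close>. So it is orthogonal to the segment from \<open>w\<close> to that point and has distance exactly
\<open>\<delta>\<close> from \<open>w\<close>.\<close>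

lemma nearest_supporting_hyperplane:
  fixes \<Omega> :: "'a :: euclidean_space set"
  assumes conv: "convex \<Omega>" and opn: "open \<Omega>" and w: "w \<in> \<Omega>" and ne: "\<Omega> \<noteq> UNIV"
  defines "\<delta> \<equiv> infdist w (- \<Omega>)"
  obtains n where "norm n = 1" "0 < \<delta>" "ball w \<delta> \<subseteq> \<Omega>" "w + \<delta> *\<^sub>R n \<notin> \<Omega>"
    "\<And>x. x \<in> \<Omega> \<Longrightarrow> (x - w) \<bullet> n < \<delta>"
proof -
  have cl: "closed (- \<Omega>)" and ne': "- \<Omega> \<noteq> {}"
    using opn ne by auto
  obtain p where p: "p \<notin> \<Omega>" "\<delta> = dist w p"
    using infdist_attains_inf[OF cl ne', of w] unfolding \<delta>_def by auto
  have \<delta>0: "0 < \<delta>"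
    using p w by auto
  have sub: "ball w \<delta> \<subseteq> \<Omega>"
  proof
    fix x assume "x \<in> ball w \<delta>"
    then show "x \<in> \<Omega>"
      using infdist_le[of x "- \<Omega>" w] by (force simp: \<delta>_def)
  qed
  obtain a b where a: "a \<noteq> 0" "\<And>x. x \<in> \<Omega> \<Longrightarrow> a \<bullet> x \<le> b" "b \<le> a \<bullet> p"
    using separating_hyperplane_sets[OF conv, of "{p}"] w p by auto
  define n where "n = a /\<^sub>R norm a"
  have n1: "norm n = 1"
    using a by (simp add: n_def)
  have le: "x \<bullet> n \<le> p \<bullet> n" if "x \<in> \<Omega>" for x
  proof -
    have "x \<bullet> a \<le> p \<bullet> a"
      using a(2)[OF that] a(3) by (simp add: inner_commute)
    then show ?thesis
      by (simp add: n_def mult_left_mono)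
  qed
  have below: "x \<bullet> n + \<epsilon> \<le> p \<bullet> n" if "ball x \<epsilon> \<subseteq> \<Omega>" "0 < \<epsilon>" for x \<epsilon>
    using that le n1 by (intro ball_below_hyperplane) auto
  have "p - w = \<delta> *\<^sub>R n"
  proof (rule eq_scaleR_normal)
    show "norm (p - w) \<le> \<delta>"
      by (simp add: p(2) dist_norm norm_minus_commute)
    show "\<delta> \<le> (p - w) \<bullet> n"
      using below[OF sub \<delta>0] by (simp add: inner_diff_left)
  qed (use n1 \<delta>0 in auto)
  then have pw: "p = w + \<delta> *\<^sub>R n"
    by (simp add: algebra_simps)
  have half: "(x - w) \<bullet> n < \<delta>" if x: "x \<in> \<Omega>" for x
  proof -
    obtain \<epsilon> where "0 < \<epsilon>" "ball x \<epsilon> \<subseteq> \<Omega>"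
      using opn x by (meson open_contains_ball)
    then have "x \<bullet> n < p \<bullet> n"
      using below[of x \<epsilon>] by linarith
    moreover have "p \<bullet> n = w \<bullet> n + \<delta>"
      using n1 by (simp add: pw inner_add_left dot_square_norm)
    ultimately show ?thesis
      by (simp add: inner_diff_left)
  qed
  show thesis
  proof (rule that[of n, OF n1 \<delta>0 sub _ half])
    show "w + \<delta> *\<^sub>R n \<notin> \<Omega>"
      unfolding pw[symmetric] by (rule p(1))
  qed
qed

text \<open>The set of centres of balls of radius \<open>\<rho>\<close> contained in \<open>\<Omega>\<close> is closed, and points of \<open>\<Omega>\<close> near \<open>p\<close>
provide centres at distance less than \<open>\<rho> + \<epsilon>\<close> from \<open>p\<close>. If \<open>p\<close> is outside \<open>\<Omega>\<close>, the
resulting ball touches the boundary at \<open>p\<close>.\<close>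

lemma union_of_balls_touching_ball:
  fixes \<Omega> :: "'a :: euclidean_space set"
  assumes \<Omega>: "\<Omega> = (\<Union>c\<in>C. ball c \<rho>)" and p: "p \<in> closure \<Omega>"
  obtains c where "ball c \<rho> \<subseteq> \<Omega>" "dist p c \<le> \<rho>"
proof -
  define S where "S = {c. ball c \<rho> \<subseteq> \<Omega>}"
  have "closure S \<subseteq> S"
  proof
    fix c assume c: "c \<in> closure S"
    have "x \<in> \<Omega>" if x: "dist c x < \<rho>" for x
    proof -
      have "0 < \<rho> - dist c x"
        using x by simp
      then obtain c' where "c' \<in> S" "dist c' c < \<rho> - dist c x"
        using c unfolding closure_approachable by blast
      then have "x \<in> ball c' \<rho>"
        using dist_triangle[of c' x c] by simp
      then show ?thesis
        using \<open>c' \<in> S\<close> by (auto simp: S_def)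
    qed
    then show "c \<in> S"
      by (auto simp: S_def)
  qed
  then have cl: "closed S"
    using closure_subset_eq by blast
  have near: "\<exists>c\<in>S. dist p c \<le> \<rho> + \<epsilon>" if e: "0 < \<epsilon>" for \<epsilon>
  proof -
    obtain y where y: "y \<in> \<Omega>" "dist y p < \<epsilon>"
      using p e unfolding closure_approachable by blast
    then obtain c where c: "c \<in> C" "dist c y < \<rho>"
      unfolding \<Omega> by auto
    then have "c \<in> S" unfolding S_def \<Omega> by blast
    moreover have "dist p c \<le> \<rho> + \<epsilon>"
      using y c dist_triangle[of p c y] by (simp add: dist_commute)
    ultimately show ?thesis by blast
  qed
  then have "S \<noteq> {}"
    using zero_less_one by blast
  then obtain c where c: "c \<in> S" "infdist p S = dist p c"
    using infdist_attains_inf[OF cl] by blast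
  have "dist p c \<le> \<rho>"
  proof (rule field_le_epsilon)
    fix \<epsilon> :: real assume "0 < \<epsilon>"
    then show "dist p c \<le> \<rho> + \<epsilon>"
      using near infdist_le2 c(2) by metis
  qed
  then show thesis
    using that c by (auto simp: S_def)
qed

section \<open>Estimates for the derivative of a conformal map\<close>

text \<open>By a rotation and a translation the supporting half-plane becomes the right half-plane with \<open>f z\<close>
at the real point \<open>\<delta>\<close>. The Cayley transform \<open>(h - \<delta>) / (h + \<delta>)\<close> maps it into the unit disc and has
derivative \<open>1 / (2 \<delta>)\<close> at that point.\<close>

lemma convex_schwarz_pick:
  assumes conv: "convex \<Omega>" and opn: "open \<Omega>" and ne: "\<Omega> \<noteq> UNIV"
    and hol: "f holomorphic_on ball 0 1" and im: "f ` ball 0 1 \<subseteq> \<Omega>" and z: "cmod z < 1"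
  shows "cmod (deriv f z) * (1 - (cmod z)\<^sup>2) \<le> 2 * infdist (f z) (- \<Omega>)"
proof -
  have fin: "f \<zeta> \<in> \<Omega>" if "cmod \<zeta> < 1" for \<zeta>
    using im that by (auto simp: image_subset_iff)
  define \<delta> where "\<delta> = infdist (f z) (- \<Omega>)"
  obtain n where n: "cmod n = 1" "0 < \<delta>" and half: "\<And>x. x \<in> \<Omega> \<Longrightarrow> (x - f z) \<bullet> n < \<delta>"
    using nearest_supporting_hyperplane[OF conv opn fin[OF z] ne] unfolding \<delta>_def by metis
  have n1: "cnj n * n = 1"
    using n(1) by (simp add: complex_norm_square[symmetric] mult.commute)
  define h where "h = (\<lambda>\<zeta>. cnj n * (f z + of_real \<delta> * n - f \<zeta>))"
  have hz: "h z = of_real \<delta>"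
    using n1 by (simp add: h_def mult.left_commute)
  have Re_h: "0 < Re (h \<zeta>)" if "cmod \<zeta> < 1" for \<zeta>
  proof -
    have "Re (h \<zeta>) = (f z + \<delta> *\<^sub>R n - f \<zeta>) \<bullet> n"
      by (simp add: h_def inner_complex_def algebra_simps)
    also have "\<dots> = \<delta> - (f \<zeta> - f z) \<bullet> n"
      using n(1) by (simp add: inner_diff_left inner_add_left dot_square_norm)
    finally show ?thesis
      using half[OF fin[OF that]] by simp
  qed
  define \<psi> where "\<psi> = (\<lambda>\<zeta>. (h \<zeta> - of_real \<delta>) / (h \<zeta> + of_real \<delta>))"
  have ne0: "h \<zeta> + of_real \<delta> \<noteq> 0" if "cmod \<zeta> < 1" for \<zeta>
    using Re_h[OF that] n(2) by (auto simp: complex_eq_iff)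
  have holh: "h holomorphic_on ball 0 1"
    unfolding h_def by (intro holomorphic_intros hol)
  have hol\<psi>: "\<psi> holomorphic_on ball 0 1"
    unfolding \<psi>_def by (intro holomorphic_intros holh) (use ne0 in auto)
  have im\<psi>: "\<psi> ` ball 0 1 \<subseteq> ball 0 1"
  proof clarify
    fix \<zeta> :: complex assume "\<zeta> \<in> ball 0 1"
    then have \<zeta>: "cmod \<zeta> < 1" by simp
    have "(cmod (h \<zeta> - of_real \<delta>))\<^sup>2 < (cmod (h \<zeta> + of_real \<delta>))\<^sup>2"
      using mult_pos_pos[OF Re_h[OF \<zeta>] n(2)] unfolding cmod_power2
      by (simp add: power2_eq_square algebra_simps)
    then have "cmod (h \<zeta> - of_real \<delta>) < cmod (h \<zeta> + of_real \<delta>)"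
      by (rule power2_less_imp_less) simp
    then show "\<psi> \<zeta> \<in> ball 0 1"
      using ne0[OF \<zeta>] by (simp add: \<psi>_def norm_divide)
  qed
  have df: "(f has_field_derivative deriv f z) (at z)"
    using hol z by (intro holomorphic_derivI[of _ "ball 0 1"]) auto
  have dh: "(h has_field_derivative - (cnj n * deriv f z)) (at z)"
    unfolding h_def by (auto intro!: derivative_eq_intros df)
  have "(\<psi> has_field_derivative - (cnj n * deriv f z) / of_real (2 * \<delta>)) (at z)"
    unfolding \<psi>_def
    by (rule derivative_eq_intros dh refl ne0[OF z] | use n(2) in \<open>simp add: hz divide_simps\<close>)+
  then have "cmod (deriv \<psi> z) = cmod (deriv f z) / (2 * \<delta>)"
    using n by (simp add: DERIV_imp_deriv norm_divide norm_mult)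
  moreover have "cmod (deriv \<psi> z) * (1 - (cmod z)\<^sup>2) \<le> 1 - (cmod (\<psi> z))\<^sup>2"
    by (rule schwarz_pick_unit(2)[OF hol\<psi> im\<psi> z])
  ultimately show ?thesis
    using n(2) by (simp add: hz \<psi>_def pos_divide_le_eq flip: \<delta>_def)
qed

text \<open>The segment has to be traversed from the centre of the larger disc. If this is \<open>c\<close> instead of \<open>0\<close>,
\<open>g\<close> is followed by the automorphism that moves \<open>g c\<close> to the origin, which preserves the distance
between \<open>g 0\<close> and \<open>g c\<close>. The angle in \<open>F\<close> is meaningful because \<open>\<bar>RI - RC\<bar> \<le> RO - RC\<close>:
the disc of radius \<open>RI\<close> about \<open>0\<close> lies in the one of radius \<open>RO\<close>, and the half-plane supporting
\<open>\<Omega>\<close> at a boundary point nearest to \<open>0\<close> contains the disc about \<open>c\<close>, so that \<open>RC - RI \<le> \<bar>c\<bar>\<close>.\<close>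

lemma artanh_norm_center_le:
  assumes RC: "R_condition RO RI RC \<Omega>" and c: "ball c RC \<subseteq> \<Omega>"
    and hol: "g holomorphic_on \<Omega>" and im: "g ` \<Omega> \<subseteq> ball 0 1" and inj: "inj_on g \<Omega>" and g0: "g 0 = 0"
  shows "artanh (cmod (g c)) \<le> F RO RI RC"
proof -
  have opn: "open \<Omega>" and conv: "convex \<Omega>" and "0 \<in> \<Omega>" and pos: "0 < RO" "0 < RI" "0 < RC"
    and RO: "\<Omega> \<subseteq> ball 0 RO" and RI: "ball 0 RI \<subseteq> \<Omega>"
    and RI_max: "\<And>r. ball 0 r \<subseteq> \<Omega> \<Longrightarrow> r \<le> RI"
    using RC by (auto simp: R_condition_def)
  have ne: "\<Omega> \<noteq> UNIV"
    using RO by (metis UNIV_I bounded_ball bounded_subset not_bounded_UNIV)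
  have "ball c RC \<subseteq> ball 0 RO"
    using c RO by blast
  then have d: "cmod c \<le> RO - RC"
    using pos by (simp add: ball_subset_ball_iff)
  have "ball (0::complex) RI \<subseteq> ball 0 RO"
    using RI RO by blast
  then have d1: "RI - RC \<le> RO - RC"
    using pos by (simp add: ball_subset_ball_iff)
  have d2: "RC - RI \<le> RO - RC"
  proof -
    obtain n where n: "cmod n = 1" "ball 0 (infdist 0 (- \<Omega>)) \<subseteq> \<Omega>"
      and half: "\<And>x. x \<in> \<Omega> \<Longrightarrow> (x - 0) \<bullet> n < infdist 0 (- \<Omega>)"
      using nearest_supporting_hyperplane[OF conv opn \<open>0 \<in> \<Omega>\<close> ne] by metis
    have "ball c RC \<subseteq> {x. x \<bullet> n \<le> RI}"
      using half c RI_max[OF n(2)] by force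
    then have "c \<bullet> n + RC \<le> RI"
      using n(1) pos by (intro ball_below_hyperplane)
    moreover have "\<bar>c \<bullet> n\<bar> \<le> cmod c"
      using Cauchy_Schwarz_ineq2[of c n] n(1) by simp
    ultimately show ?thesis
      using d by linarith
  qed
  show ?thesis
  proof (cases "RC \<le> RI")
    case True
    have "artanh (cmod (g c)) \<le> F (RI + (RO - RC)) RC RI"
      by (rule artanh_norm_le_F[OF conv opn hol im inj RI c]) (use pos True d d1 g0 in auto)
    then show ?thesis
      by (simp only: F_def max.commute min.commute add_diff_cancel_left')
  next
    case False
    have "c \<in> \<Omega>"
      using c pos by auto
    have lt1: "cmod (g x) < 1" if "x \<in> \<Omega>" for x
      using im that by (auto simp: image_subset_iff)
    define M where "M = Moebius_function 0 (g c)"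
    have M: "cmod (M x) < 1" "Moebius_function 0 (- g c) (M x) = x" if "cmod x < 1" for x
      unfolding M_def using that lt1[OF \<open>c \<in> \<Omega>\<close>]
      by (auto intro: Moebius_function_norm_lt_1 Moebius_function_compose)
    have "artanh (cmod ((M \<circ> g) 0)) \<le> F (RC + (RO - RC)) RI RC"
    proof (rule artanh_norm_le_F[OF conv opn _ _ _ c RI])
      show "(M \<circ> g) holomorphic_on \<Omega>"
        using Moebius_function_holomorphic[OF lt1[OF \<open>c \<in> \<Omega>\<close>], of 0] im unfolding M_def
        by (intro holomorphic_on_compose_gen[OF hol])
      show "(M \<circ> g) ` \<Omega> \<subseteq> ball 0 1"
        using M(1) lt1 by auto
      show "inj_on (M \<circ> g) \<Omega>"
      proof (rule comp_inj_on[OF inj])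
        show "inj_on M (g ` \<Omega>)"
          by (rule inj_on_inverseI[of _ "Moebius_function 0 (- g c)"]) (use M(2) lt1 in auto)
      qed
      show "(M \<circ> g) c = 0"
        by (simp add: M_def Moebius_function_eq_zero)
    qed (use pos False d d2 in auto)
    then show ?thesis
      by (simp add: M_def g0 Moebius_function_of_zero)
  qed
qed

text \<open>With \<open>\<alpha> = \<bar>g c\<bar>\<close> and \<open>x = 1 - \<delta> / RC\<close>, the distance estimates give
\<open>\<bar>z\<bar> \<le> (\<alpha> + x) / (1 + \<alpha> x)\<close>, a lower bound for \<open>1 - \<bar>z\<bar>\<^sup>2\<close> in which the factor \<open>1 - x\<close>
cancels against \<open>\<delta> = RC (1 - x)\<close>. What remains is \<open>(1 + \<alpha>) / (1 - \<alpha>) = exp (2 artanh \<alpha>)\<close>.\<close>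

lemma deriv_le_of_touching_disc:
  assumes RC: "R_condition RO RI RC \<Omega>"
    and hol: "f holomorphic_on ball 0 1" and im: "f ` ball 0 1 \<subseteq> \<Omega>"
    and holg: "g holomorphic_on \<Omega>" and img: "g ` \<Omega> \<subseteq> ball 0 1" and inj: "inj_on g \<Omega>"
    and gf: "\<And>z. cmod z < 1 \<Longrightarrow> g (f z) = z" and f0: "f 0 = 0"
    and z: "cmod z < 1" and near: "infdist (f z) (- \<Omega>) \<le> RC"
  shows "cmod (deriv f z) \<le> 2 * (RC * exp (2 * F RO RI RC)) / (2 - infdist (f z) (- \<Omega>) / RC)"
proof -
  have opn: "open \<Omega>" and conv: "convex \<Omega>" and pos: "0 < RC"
    and RO: "\<Omega> \<subseteq> ball 0 RO" and "\<exists>C. \<Omega> = (\<Union>c\<in>C. ball c RC)"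
    using RC by (auto simp: R_condition_def)
  then obtain C where C: "\<Omega> = (\<Union>c\<in>C. ball c RC)" by blast
  have ne: "\<Omega> \<noteq> UNIV"
    using RO by (metis bounded_ball bounded_subset not_bounded_UNIV)
  define w where "w = f z"
  define \<delta> where "\<delta> = infdist w (- \<Omega>)"
  have w: "w \<in> \<Omega>"
    using im z by (auto simp: w_def)
  obtain n where n: "cmod n = 1" "0 < \<delta>" "ball w \<delta> \<subseteq> \<Omega>" "w + \<delta> *\<^sub>R n \<notin> \<Omega>"
    and half: "\<And>x. x \<in> \<Omega> \<Longrightarrow> (x - w) \<bullet> n < \<delta>"
    using nearest_supporting_hyperplane[OF conv opn w ne] unfolding \<delta>_def by metis
  have nn: "n \<bullet> n = 1"
    using n(1) by (simp add: dot_square_norm)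
  define p where "p = w + \<delta> *\<^sub>R n"
  have "p \<in> cball w \<delta>"
    using n by (simp add: p_def dist_norm)
  also have "cball w \<delta> \<subseteq> closure \<Omega>"
    using closure_mono[OF n(3)] n(2) by simp
  finally obtain c where c: "ball c RC \<subseteq> \<Omega>" "dist p c \<le> RC"
    using union_of_balls_touching_ball[OF C] by blast
  have "ball c RC \<subseteq> {x. x \<bullet> n \<le> p \<bullet> n}"
  proof
    fix x assume "x \<in> ball c RC"
    then show "x \<in> {x. x \<bullet> n \<le> p \<bullet> n}"
      using half[of x] c(1) nn by (auto simp: p_def inner_diff_left inner_add_left)
  qed
  then have "c \<bullet> n + RC \<le> p \<bullet> n"
    using n(1) pos by (intro ball_below_hyperplane)
  then have "p - c = RC *\<^sub>R n"
    using c(2) n(1) pos by (intro eq_scaleR_normal) (auto simp: dist_norm inner_diff_left)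
  then have "w - c = (RC - \<delta>) *\<^sub>R n"
    by (simp add: p_def algebra_simps)
  then have wc: "cmod (w - c) = RC - \<delta>"
    using n(1) near by (simp add: \<delta>_def w_def)
  define \<alpha> where "\<alpha> = cmod (g c)"
  define x where "x = cmod (w - c) / RC"
  have x: "0 \<le> x" "x < 1" "1 + x = 2 - \<delta> / RC" "\<delta> = RC * (1 - x)"
    using pos n(2) by (auto simp: x_def) (auto simp: wc field_simps)
  have "c \<in> \<Omega>"
    using c pos by auto
  then have \<alpha>: "0 \<le> \<alpha>" "\<alpha> < 1"
    using img by (auto simp: \<alpha>_def image_subset_iff)
  have gw: "g w = z"
    using gf[OF z] by (simp add: w_def)
  have zz: "0 < 1 - (cmod z)\<^sup>2"
    using z by (simp add: abs_square_less_1)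
  have "cmod (Moebius_function 0 (g c) (g w)) \<le> x"
    unfolding x_def using holg img c(1) wc n(2)
    by (intro schwarz_pick_disc(1)) (auto intro: holomorphic_on_subset)
  then have M: "cmod (Moebius_function 0 (g c) z) \<le> x"
    by (simp add: gw)
  have z\<alpha>: "0 \<le> 1 - cmod z * \<alpha>"
    using z \<alpha> by (simp add: mult_le_one)
  have "\<bar>cmod z - \<alpha>\<bar> \<le> cmod (Moebius_function 0 (g c) z) * (1 - cmod z * \<alpha>)"
    unfolding \<alpha>_def using z \<alpha> by (intro norm_Moebius_ge) (auto simp: \<alpha>_def)
  also have "\<dots> \<le> x * (1 - cmod z * \<alpha>)"
    using M z\<alpha> by (rule mult_right_mono)
  finally have "cmod z * (1 + \<alpha> * x) \<le> \<alpha> + x"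
    by (simp add: algebra_simps)
  then have "(cmod z * (1 + \<alpha> * x))\<^sup>2 \<le> (\<alpha> + x)\<^sup>2"
    using \<alpha> x by (intro power_mono) auto
  then have "(1 - \<alpha>\<^sup>2) * (1 - x\<^sup>2) \<le> (1 + \<alpha> * x)\<^sup>2 * (1 - (cmod z)\<^sup>2)"
    by (simp add: power_mult_distrib algebra_simps power2_eq_square)
  then have "cmod (deriv f z) * ((1 - \<alpha>\<^sup>2) * (1 - x\<^sup>2)) \<le>
      cmod (deriv f z) * ((1 + \<alpha> * x)\<^sup>2 * (1 - (cmod z)\<^sup>2))"
    by (rule mult_left_mono) simp
  also have "\<dots> = (1 + \<alpha> * x)\<^sup>2 * (cmod (deriv f z) * (1 - (cmod z)\<^sup>2))"
    by (simp add: mult_ac)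
  also have "\<dots> \<le> (1 + \<alpha> * x)\<^sup>2 * (2 * \<delta>)"
    using convex_schwarz_pick[OF conv opn ne hol im z]
    by (intro mult_left_mono) (auto simp: \<delta>_def w_def)
  also have "\<dots> \<le> (1 + \<alpha>)\<^sup>2 * (2 * \<delta>)"
    using \<alpha> x n(2) by (intro mult_right_mono power_mono) (auto simp: mult_left_le)
  also have "\<dots> = ((1 + \<alpha>) * (1 - x)) * (2 * RC * (1 + \<alpha>))"
    unfolding x(4) by (simp add: power2_eq_square algebra_simps)
  also have "cmod (deriv f z) * ((1 - \<alpha>\<^sup>2) * (1 - x\<^sup>2)) =
      ((1 + \<alpha>) * (1 - x)) * (cmod (deriv f z) * ((1 - \<alpha>) * (1 + x)))"
    by (simp add: power2_eq_square algebra_simps)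
  finally have "cmod (deriv f z) * ((1 - \<alpha>) * (1 + x)) \<le> 2 * RC * (1 + \<alpha>)"
    using \<alpha> x(1,2) by (simp add: mult_le_cancel_left_pos)
  then have "cmod (deriv f z) * (1 + x) \<le> 2 * RC * ((1 + \<alpha>) / (1 - \<alpha>))"
    using \<alpha> by (simp add: pos_le_divide_eq mult_ac)
  also have "(1 + \<alpha>) / (1 - \<alpha>) = exp (2 * artanh \<alpha>)"
    using \<alpha> by (simp add: artanh_def)
  also have "\<dots> \<le> exp (2 * F RO RI RC)"
    using artanh_norm_center_le[OF RC c(1) holg img inj] gf[of 0] f0 by (simp add: \<alpha>_def)
  finally have "cmod (deriv f z) * (1 + x) \<le> 2 * (RC * exp (2 * F RO RI RC))"
    using pos by (simp add: mult_left_mono)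
  then have "cmod (deriv f z) \<le> 2 * (RC * exp (2 * F RO RI RC)) / (1 + x)"
    using x(1) by (simp add: pos_le_divide_eq)
  then show ?thesis
    by (simp add: x(3) \<delta>_def w_def)
qed

lemma holomorphic_norm_le_of_annulus:
  assumes hol: "h holomorphic_on ball 0 1" and "r < 1"
    and bound: "\<And>z. r < cmod z \<Longrightarrow> cmod z < 1 \<Longrightarrow> cmod (h z) \<le> M" and z: "cmod z < 1"
  shows "cmod (h z) \<le> M"
proof -
  obtain s where s: "max r (cmod z) < s" "s < 1"
    using \<open>r < 1\<close> z dense by (metis max_less_iff_conj)
  have s0: "0 < s"
    using s norm_ge_zero[of z] by linarith
  have sub: "cball (0::complex) s \<subseteq> ball 0 1"
    using s by auto
  show ?thesis
  proof (rule maximum_modulus_frontier[of h "ball 0 s"])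
    show "h holomorphic_on interior (ball 0 s)"
      using holomorphic_on_subset[OF hol subset_trans[OF ball_subset_cball sub]] by simp
    show "continuous_on (closure (ball 0 s)) h"
      using holomorphic_on_imp_continuous_on[OF hol] sub s0 by (auto intro: continuous_on_subset)
    show "cmod (h \<zeta>) \<le> M" if "\<zeta> \<in> frontier (ball 0 s)" for \<zeta>
      using that s s0 by (intro bound) (auto simp: frontier_ball)
  qed (use s in auto)
qed

lemma inverse_of_conformal_map:
  assumes "conformal_map_onto f \<Omega>"
  obtains g where "g holomorphic_on \<Omega>" "g ` \<Omega> \<subseteq> ball 0 1" "inj_on g \<Omega>"
    "\<And>z. cmod z < 1 \<Longrightarrow> g (f z) = z" "\<And>w. w \<in> \<Omega> \<Longrightarrow> f (g w) = w"
proof -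
  have hol: "f holomorphic_on ball 0 1" and inj: "inj_on f (ball 0 1)" and im: "f ` ball 0 1 = \<Omega>"
    using assms by (auto simp: conformal_map_onto_def bij_betw_def)
  obtain g where g: "g holomorphic_on \<Omega>" "\<And>z. z \<in> ball 0 1 \<Longrightarrow> g (f z) = z"
    using holomorphic_has_inverse[OF hol open_ball inj] unfolding im by metis
  show thesis
  proof (rule that[of g])
    show fg: "f (g w) = w" if "w \<in> \<Omega>" for w
      using that g(2) unfolding im[symmetric] by auto
    show "inj_on g \<Omega>"
      using fg by (rule inj_on_inverseI)
    show "g ` \<Omega> \<subseteq> ball 0 1"
      using g(2) unfolding im[symmetric] by auto
  qed (use g in auto)
qed

text \<open>The points of \<open>\<Omega>\<close> at distance at least \<open>\<epsilon> RC\<close> from the complement form a compact set, whose preimage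
lies in a smaller disc. Outside this disc the touching-disc estimate holds with \<open>\<delta> / RC < \<epsilon>\<close>, the
maximum modulus principle extends it inwards, and finally \<open>\<epsilon>\<close> tends to \<open>0\<close>.\<close>

lemma deriv_conformal_map_le:
  assumes RC: "R_condition RO RI RC \<Omega>" and f: "conformal_map_onto f \<Omega>" and f0: "f 0 = 0"
    and z: "cmod z < 1"
  shows "cmod (deriv f z) \<le> RC * exp (2 * F RO RI RC)"
proof -
  have opn: "open \<Omega>" and pos: "0 < RC" and RO: "\<Omega> \<subseteq> ball 0 RO"
    using RC by (auto simp: R_condition_def)
  have hol: "f holomorphic_on ball 0 1" and im: "f ` ball 0 1 = \<Omega>"
    using f by (auto simp: conformal_map_onto_def bij_betw_def)
  obtain g where holg: "g holomorphic_on \<Omega>" and img: "g ` \<Omega> \<subseteq> ball 0 1" and inj: "inj_on g \<Omega>"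
    and gf: "\<And>z. cmod z < 1 \<Longrightarrow> g (f z) = z"
    using inverse_of_conformal_map[OF f] by metis
  define X where "X = RC * exp (2 * F RO RI RC)"
  have X0: "0 < X"
    using pos by (simp add: X_def)
  have bound: "cmod (deriv f z) \<le> 2 * X / (2 - \<epsilon>)" if \<epsilon>: "0 < \<epsilon>" "\<epsilon> < 1" for \<epsilon>
  proof -
    define K where "K = {w \<in> closure \<Omega>. \<epsilon> * RC \<le> infdist w (- \<Omega>)}"
    have "closed K"
      unfolding K_def by (intro closed_Collect_conj closed_Collect_le continuous_intros) auto
    moreover have "bounded K"
      unfolding K_def using bounded_closure[OF bounded_subset[OF bounded_ball RO]]
      by (rule bounded_subset) auto
    ultimately have "compact K"
      by (simp add: compact_eq_bounded_closed)
    moreover have K: "K \<subseteq> \<Omega>"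
    proof
      fix w assume "w \<in> K"
      moreover have "0 < \<epsilon> * RC"
        using \<epsilon> pos by simp
      ultimately show "w \<in> \<Omega>"
        by (cases "w \<in> \<Omega>") (simp_all add: K_def)
    qed
    ultimately have "compact (g ` K)"
      using holg by (intro compact_continuous_image)
        (auto intro: continuous_on_subset holomorphic_on_imp_continuous_on)
    moreover have "g ` K \<subseteq> ball 0 1"
      using K img by blast
    ultimately have "\<exists>r<1. g ` K \<subseteq> cball 0 r"
    proof (cases "K = {}")
      case False
      assume "compact (g ` K)" "g ` K \<subseteq> ball 0 1"
      then obtain \<zeta> where "\<zeta> \<in> g ` K" "\<forall>\<xi>\<in>g ` K. cmod \<xi> \<le> cmod \<zeta>"
        using continuous_attains_sup[of "g ` K" cmod] False by (auto intro: continuous_intros)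
      then show ?thesis
        using \<open>g ` K \<subseteq> ball 0 1\<close> by (intro exI[of _ "cmod \<zeta>"]) auto
    qed (auto intro: exI[of _ 0])
    then obtain r where r: "r < 1" "g ` K \<subseteq> cball 0 r"
      by blast
    show ?thesis
    proof (rule holomorphic_norm_le_of_annulus[OF _ r(1) _ z])
      show "deriv f holomorphic_on ball 0 1"
        using hol by (intro holomorphic_deriv) auto
      fix \<zeta> assume \<zeta>: "r < cmod \<zeta>" "cmod \<zeta> < 1"
      define \<delta> where "\<delta> = infdist (f \<zeta>) (- \<Omega>)"
      have "f \<zeta> \<in> \<Omega>"
        using im \<zeta> by auto
      have "f \<zeta> \<notin> K"
        using r(2) \<zeta> gf[OF \<zeta>(2)] by force
      then have \<delta>: "\<delta> < \<epsilon> * RC"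
        using \<open>f \<zeta> \<in> \<Omega>\<close> closure_subset by (auto simp: K_def \<delta>_def)
      also have "\<dots> \<le> 1 * RC"
        using \<epsilon> pos by (intro mult_right_mono) auto
      finally have "cmod (deriv f \<zeta>) \<le> 2 * X / (2 - \<delta> / RC)"
        unfolding X_def \<delta>_def using im gf f0 \<zeta>
        by (intro deriv_le_of_touching_disc[OF RC hol _ holg img inj]) auto
      also have "\<dots> \<le> 2 * X / (2 - \<epsilon>)"
      proof (rule divide_left_mono)
        have "\<delta> / RC < \<epsilon>"
          using \<delta> pos by (simp add: pos_divide_less_eq)
        then show "2 - \<epsilon> \<le> 2 - \<delta> / RC" "0 < (2 - \<delta> / RC) * (2 - \<epsilon>)"
          using \<epsilon> by (auto intro: mult_pos_pos)
      qed (use X0 in auto)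
      finally show "cmod (deriv f \<zeta>) \<le> 2 * X / (2 - \<epsilon>)" .
    qed
  qed
  have "((\<lambda>\<epsilon>. 2 * X / (2 - \<epsilon>)) \<longlongrightarrow> 2 * X / (2 - 0)) (at_right 0)"
    by (intro tendsto_intros) auto
  moreover have "eventually (\<lambda>\<epsilon>. cmod (deriv f z) \<le> 2 * X / (2 - \<epsilon>)) (at_right 0)"
    using eventually_at_right_real[of 0 1] by (rule eventually_mono) (use bound in auto)
  ultimately have "cmod (deriv f z) \<le> 2 * X / (2 - 0)"
    by (rule tendsto_lowerbound) simp
  then show ?thesis
    by (simp add: X_def)
qed

lemma Hinf_norm_le_iff: "Hinf_norm h \<le> ereal M \<longleftrightarrow> (\<forall>z. cmod z < 1 \<longrightarrow> cmod (h z) \<le> M)"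
  by (auto simp: Hinf_norm_def SUP_le_iff)

section \<open>Discs\<close>

lemma C11_boundary_ball:
  assumes "0 < \<rho>"
  shows "C11_boundary (ball b \<rho>)"
proof -
  define \<gamma> where "\<gamma> = (\<lambda>t. b + of_real \<rho> * cis (t / \<rho>))"
  define \<gamma>' where "\<gamma>' = (\<lambda>t. \<i> * cis (t / \<rho>))"
  have dcis: "((\<lambda>t. cis (t / \<rho>)) has_vector_derivative \<gamma>' t / of_real \<rho>) (at t)" for t
  proof -
    have "((\<lambda>z. exp (\<i> * (z / of_real \<rho>))) has_field_derivative
        exp (\<i> * (of_real t / of_real \<rho>)) * (\<i> / of_real \<rho>)) (at (of_real t))"
      using assms by (auto intro!: derivative_eq_intros)
    then show ?thesis
      using has_vector_derivative_real_field[of "\<lambda>z. exp (\<i> * (z / of_real \<rho>))"]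
      by (simp add: \<gamma>'_def cis_conv_exp mult_ac)
  qed
  have d\<gamma>: "(\<gamma> has_vector_derivative \<gamma>' t) (at t)" for t
    unfolding \<gamma>_def using assms
    by (auto intro!: derivative_eq_intros dcis)
  have d\<gamma>': "(\<gamma>' has_vector_derivative \<i> * (\<gamma>' t / of_real \<rho>)) (at t)" for t
    unfolding \<gamma>'_def
    by (auto intro!: derivative_eq_intros dcis simp: \<gamma>'_def)
  have lip: "(1 / \<rho>)-lipschitz_on UNIV \<gamma>'"
  proof (rule lipschitz_onI)
    fix s t
    have "norm (\<gamma>' s - \<gamma>' t) \<le> 1 / \<rho> * norm (s - t)"
      using assms d\<gamma>'[unfolded has_vector_derivative_def]
      by (intro differentiable_bound[of UNIV \<gamma>' "\<lambda>t h. h *\<^sub>R (\<i> * (\<gamma>' t / of_real \<rho>))"])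
         (auto intro!: onorm_bound simp: norm_mult norm_divide \<gamma>'_def has_derivative_at_withinI)
    then show "dist (\<gamma>' s) (\<gamma>' t) \<le> 1 / \<rho> * dist s t"
      by (simp add: dist_norm)
  qed (use assms in auto)
  have inj: "inj_on \<gamma> {0..<2 * pi * \<rho>}"
  proof (rule inj_onI)
    fix s t assume st: "s \<in> {0..<2 * pi * \<rho>}" "t \<in> {0..<2 * pi * \<rho>}" and eq: "\<gamma> s = \<gamma> t"
    have "cis (s / \<rho>) = cis (t / \<rho>)"
      using eq assms by (simp add: \<gamma>_def)
    moreover have "s / \<rho> \<in> {0..<2 * pi}" "t / \<rho> \<in> {0..<2 * pi}"
      using st assms by (auto simp: pos_divide_less_eq)
    moreover from calculation obtain k :: int where k: "s / \<rho> = t / \<rho> + 2 * pi * k"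
      using sin_cos_eq_iff[of "s / \<rho>" "t / \<rho>"] by (auto simp: complex_eq_iff)
    ultimately have "\<bar>2 * pi * k\<bar> < 2 * pi"
      by auto
    then have "k = 0"
      by (simp add: abs_mult)
    then show "s = t"
      using k assms by simp
  qed
  have "range \<gamma> = sphere b \<rho>"
  proof
    show "range \<gamma> \<subseteq> sphere b \<rho>"
      using assms by (auto simp: \<gamma>_def dist_norm norm_mult)
    show "sphere b \<rho> \<subseteq> range \<gamma>"
    proof
      fix w assume "w \<in> sphere b \<rho>"
      then have "cmod (w - b) = \<rho>"
        by (simp add: dist_norm norm_minus_commute)
      then have "w = \<gamma> (\<rho> * Arg (w - b))"
        using assms rcis_cmod_Arg[of "w - b"] by (simp add: \<gamma>_def rcis_def)
      then show "w \<in> range \<gamma>" by blast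
    qed
  qed
  then have "range \<gamma> = frontier (ball b \<rho>)"
    using assms by (simp add: frontier_ball)
  moreover have "\<gamma> (t + 2 * pi * \<rho>) = \<gamma> t" for t
    using assms by (simp add: \<gamma>_def add_divide_distrib flip: cis_mult)
  moreover have "cmod (\<gamma>' t) = 1" for t
    by (simp add: \<gamma>'_def norm_mult)
  moreover have "0 < 2 * pi * \<rho>"
    using assms by simp
  ultimately show ?thesis
    unfolding C11_boundary_def using d\<gamma> inj lip by blast
qed

lemma R_condition_ball_iff:
  assumes b: "cmod b < \<rho>"
  shows "R_condition RO RI \<rho> (ball b \<rho>) \<longleftrightarrow> RO = \<rho> + cmod b \<and> RI = \<rho> - cmod b"
proof -
  have \<rho>: "0 < \<rho>"
    using b norm_ge_zero[of b] by linarith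
  have out: "ball b \<rho> \<subseteq> ball 0 r \<longleftrightarrow> \<rho> + cmod b \<le> r" for r
    using \<rho> by (auto simp: ball_subset_ball_iff)
  have inn: "ball 0 r \<subseteq> ball b \<rho> \<longleftrightarrow> r \<le> \<rho> - cmod b" for r
    using b by (auto simp: ball_subset_ball_iff)
  have un: "\<exists>C. ball b \<rho> = (\<Union>c\<in>C. ball c \<rho>)"
    by (rule exI[of _ "{b}"]) simp
  show ?thesis
    unfolding R_condition_def out inn
    using \<rho> b un C11_boundary_ball[OF \<rho>, of b] norm_ge_zero[of b]
    by (auto simp: convex_imp_simply_connected intro: antisym simp del: norm_ge_zero)
qed

text \<open>The big disc is centred at \<open>b\<close>, and the disc of radius \<open>RI\<close> about \<open>0\<close> is internally tangent to it. So
\<open>\<theta> = \<pi> / 2\<close> and the second branch of \<open>F\<close> applies, except for \<open>b = 0\<close>, where the radii agree and \<open>F\<close> vanishes.\<close>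

lemma F_disc:
  assumes b: "cmod b < \<rho>"
  shows "\<rho> * exp (2 * F (\<rho> + cmod b) (\<rho> - cmod b) \<rho>) = \<rho> * ((\<rho> + cmod b) / (\<rho> - cmod b))"
proof (cases "b = 0")
  case True
  then show ?thesis
    by (simp add: F_def)
next
  case False
  have "tan (pi / 2 / 2) = (1::real)"
    by (simp add: tan_45)
  then have eq: "2 * F (\<rho> + cmod b) (\<rho> - cmod b) \<rho> = ln ((\<rho> + cmod b) / (\<rho> - cmod b))"
    using False b by (simp add: F_def Let_def)
  have "0 < (\<rho> + cmod b) / (\<rho> - cmod b)"
    using b norm_ge_zero[of b] by (intro divide_pos_pos) linarith+
  then show ?thesis
    by (simp add: eq)
qed

text \<open>For \<open>b \<noteq> 0\<close> and \<open>s\<close> tending to \<open>1\<close>, the points \<open>w = b + \<rho> s b / \<bar>b\<bar>\<close> approach the boundary point of the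
disc farthest from \<open>0\<close>. There Schwarz-Pick
for \<open>f\<close> bounds \<open>\<bar>z\<bar>\<close> from below, and Schwarz-Pick for the inverse bounds \<open>\<bar>f' z\<bar> (1 - \<bar>z\<bar>\<^sup>2)\<close> from below by
\<open>\<rho> (1 - s\<^sup>2)\<close>. Together they give \<open>\<bar>f' z\<bar> \<ge> \<rho> (1 + s a)\<^sup>2 / (1 - a\<^sup>2)\<close> with \<open>a = \<bar>b\<bar> / \<rho>\<close>.\<close>

lemma deriv_conformal_map_disc_ge:
  assumes b: "cmod b < \<rho>" and f: "conformal_map_onto f (ball b \<rho>)" and f0: "f 0 = 0"
    and bound: "\<And>z. cmod z < 1 \<Longrightarrow> cmod (deriv f z) \<le> M"
  shows "\<rho> * ((\<rho> + cmod b) / (\<rho> - cmod b)) \<le> M"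
proof -
  have \<rho>: "0 < \<rho>"
    using b norm_ge_zero[of b] by linarith
  define a where "a = cmod b / \<rho>"
  have a: "0 \<le> a" "a < 1"
    using b \<rho> by (auto simp: a_def)
  \<comment> \<open>For \<open>b = 0\<close> all directions are equivalent, whereas \<open>sgn 0 = 0\<close> is not a direction.\<close>
  define n where "n = (if b = 0 then 1 else sgn b)"
  have "cmod n = 1"
    by (simp add: n_def norm_sgn)
  moreover have "b = of_real (\<rho> * a) * n"
    using \<rho> by (simp add: n_def a_def sgn_div_norm scaleR_conv_of_real)
  ultimately have n: "cmod n = 1" "b = of_real (\<rho> * a) * n" .
  have nn: "n * cnj n = 1" "cnj n * n = 1"
    using n(1) by (simp_all add: complex_norm_square[symmetric] mult.commute)
  have hol: "f holomorphic_on ball 0 1" and im: "f ` ball 0 1 = ball b \<rho>"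
    using f by (auto simp: conformal_map_onto_def bij_betw_def)
  obtain g where holg: "g holomorphic_on ball b \<rho>" and img: "g ` ball b \<rho> \<subseteq> ball 0 1"
    and gf: "\<And>z. cmod z < 1 \<Longrightarrow> g (f z) = z" and fg: "\<And>w. w \<in> ball b \<rho> \<Longrightarrow> f (g w) = w"
    using inverse_of_conformal_map[OF f] by metis
  define \<phi> where "\<phi> = (\<lambda>z. (f z - b) / of_real \<rho>)"
  have hol\<phi>: "\<phi> holomorphic_on ball 0 1"
    unfolding \<phi>_def using \<rho> by (intro holomorphic_intros hol) auto
  have im\<phi>: "\<phi> ` ball 0 1 \<subseteq> ball 0 1"
  proof clarify
    fix z :: complex assume "z \<in> ball 0 1"
    then have "f z \<in> ball b \<rho>"
      using im by blast
    then show "\<phi> z \<in> ball 0 1"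
      using \<rho> by (simp add: \<phi>_def norm_divide dist_norm norm_minus_commute)
  qed
  have \<phi>0: "\<phi> 0 = - (of_real a * n)"
    using \<rho> by (simp add: \<phi>_def f0 n(2))
  have ge: "\<rho> * (1 + s * a)\<^sup>2 / (1 - a\<^sup>2) \<le> M" if s: "0 < s" "s < 1" for s
  proof -
    define w where "w = b + of_real (\<rho> * s) * n"
    have wb: "cmod (w - b) = \<rho> * s"
      using \<rho> s n(1) by (simp add: w_def norm_mult)
    have w: "w \<in> ball b \<rho>"
      using wb \<rho> s by (simp add: dist_norm norm_minus_commute)
    define z where "z = g w"
    have z: "cmod z < 1"
      using img w by (auto simp: z_def image_subset_iff)
    have fz: "f z = w"
      using fg[OF w] by (simp add: z_def)
    have \<phi>z: "\<phi> z = of_real s * n"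
      using \<rho> by (simp add: \<phi>_def fz w_def)
    have sa: "0 < 1 + s * a"
      using s a by (simp add: add_pos_nonneg)
    have "Moebius_function 0 (\<phi> 0) (\<phi> z) = of_real (s + a) * n / of_real (1 + s * a)"
      unfolding Moebius_function_simple \<phi>z \<phi>0 using nn by (simp add: algebra_simps)
    then have "cmod (Moebius_function 0 (\<phi> 0) (\<phi> z)) = (s + a) / (1 + s * a)"
      using s a sa n(1) by (simp add: norm_mult norm_divide del: of_real_add of_real_mult of_real_1)
    then have "(s + a) / (1 + s * a) \<le> cmod z"
      using schwarz_pick_unit(1)[OF hol\<phi> im\<phi> _ z, of 0] by (simp add: Moebius_function_simple)
    then have "s + a \<le> cmod z * (1 + s * a)"
      using sa by (simp add: pos_divide_le_eq)
    then have "(s + a)\<^sup>2 \<le> (cmod z * (1 + s * a))\<^sup>2"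
      using s a by (intro power_mono) auto
    then have z2: "(1 + s * a)\<^sup>2 * (1 - (cmod z)\<^sup>2) \<le> (1 - s\<^sup>2) * (1 - a\<^sup>2)"
      by (simp add: power_mult_distrib algebra_simps power2_eq_square)
    have pos: "0 < 1 - s\<^sup>2" "0 < 1 - a\<^sup>2"
      using s a by (auto simp: abs_square_less_1)
    have "f holomorphic_on ball 0 1" "z \<in> ball 0 1"
      using hol z by auto
    then have df: "(f has_field_derivative deriv f z) (at z)"
      by (intro holomorphic_derivI[of _ "ball 0 1"]) auto
    have dg: "(g has_field_derivative deriv g w) (at (f z))"
      unfolding fz using holg w by (intro holomorphic_derivI[of _ "ball b \<rho>"]) auto
    have "((g \<circ> f) has_field_derivative deriv g w * deriv f z) (at z)"
      by (rule DERIV_chain[OF dg df])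
    moreover have "((g \<circ> f) has_field_derivative 1) (at z)"
      by (rule has_field_derivative_transform_within_open[of "\<lambda>z. z" _ _ "ball 0 1"])
         (use z gf in auto)
    ultimately have prod: "cmod (deriv g w) * cmod (deriv f z) = 1"
      by (metis DERIV_unique norm_mult norm_one)
    have "cmod (deriv g w) * (\<rho>\<^sup>2 - (cmod (w - b))\<^sup>2) \<le> \<rho> * (1 - (cmod (g w))\<^sup>2)"
      using holg img wb \<rho> s by (intro schwarz_pick_disc(2)) auto
    then have "cmod (deriv g w) * (\<rho> * (\<rho> * (1 - s\<^sup>2))) \<le> \<rho> * (1 - (cmod z)\<^sup>2)"
      by (simp add: wb z_def power_mult_distrib algebra_simps power2_eq_square)
    then have "cmod (deriv g w) * (\<rho> * (1 - s\<^sup>2)) \<le> 1 - (cmod z)\<^sup>2"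
      using \<rho> by (simp add: mult.left_commute)
    then have "cmod (deriv f z) * (cmod (deriv g w) * (\<rho> * (1 - s\<^sup>2))) \<le> cmod (deriv f z) * (1 - (cmod z)\<^sup>2)"
      by (rule mult_left_mono) simp
    then have "\<rho> * (1 - s\<^sup>2) \<le> cmod (deriv f z) * (1 - (cmod z)\<^sup>2)"
      using prod by (metis mult.assoc mult.commute mult_1)
    then have "(1 + s * a)\<^sup>2 * (\<rho> * (1 - s\<^sup>2)) \<le> (1 + s * a)\<^sup>2 * (cmod (deriv f z) * (1 - (cmod z)\<^sup>2))"
      by (rule mult_left_mono) simp
    also have "\<dots> = cmod (deriv f z) * ((1 + s * a)\<^sup>2 * (1 - (cmod z)\<^sup>2))"
      by (simp add: mult_ac)
    also have "\<dots> \<le> cmod (deriv f z) * ((1 - s\<^sup>2) * (1 - a\<^sup>2))"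
      using z2 by (rule mult_left_mono) simp
    also have "\<dots> \<le> M * ((1 - s\<^sup>2) * (1 - a\<^sup>2))"
      using bound[OF z] pos by (intro mult_right_mono) auto
    finally have "(1 - s\<^sup>2) * (\<rho> * (1 + s * a)\<^sup>2) \<le> (1 - s\<^sup>2) * (M * (1 - a\<^sup>2))"
      by (simp add: mult_ac)
    then have "\<rho> * (1 + s * a)\<^sup>2 \<le> M * (1 - a\<^sup>2)"
      using pos by (simp add: mult_le_cancel_left_pos)
    then show ?thesis
      using pos by (simp add: pos_divide_le_eq)
  qed
  have "((\<lambda>s. \<rho> * (1 + s * a)\<^sup>2 / (1 - a\<^sup>2)) \<longlongrightarrow> \<rho> * (1 + 1 * a)\<^sup>2 / (1 - a\<^sup>2)) (at_left 1)"
    using a by (intro tendsto_intros) (auto simp: power2_eq_1_iff)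
  moreover have "eventually (\<lambda>s. \<rho> * (1 + s * a)\<^sup>2 / (1 - a\<^sup>2) \<le> M) (at_left 1)"
    using eventually_at_left_real[of 0 1] by (rule eventually_mono) (use ge in auto)
  ultimately have "\<rho> * (1 + 1 * a)\<^sup>2 / (1 - a\<^sup>2) \<le> M"
    by (rule tendsto_upperbound) simp
  also have "\<rho> * (1 + 1 * a)\<^sup>2 / (1 - a\<^sup>2) = \<rho> * ((1 + a) / (1 - a))"
  proof -
    have "1 - a\<^sup>2 = (1 + a) * (1 - a)"
      by (simp add: power2_eq_square algebra_simps)
    then show ?thesis
      using a by (simp add: power2_eq_square)
  qed
  also have "(1 + a) / (1 - a) = (\<rho> + cmod b) / (\<rho> - cmod b)"
  proof -
    have "1 + a = (\<rho> + cmod b) / \<rho>" "1 - a = (\<rho> - cmod b) / \<rho>"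
      using \<rho> by (simp_all add: a_def add_divide_distrib diff_divide_distrib)
    then show ?thesis
      using \<rho> by simp
  qed
  finally show ?thesis .
qed

section \<open>The sharp bound for the derivative\<close>

theorem mainTheorem1:
  shows
    "(\<forall>(RO::real) (RI::real) (RC::real) (\<Omega>::complex set).
        RO > 0 \<longrightarrow> RI > 0 \<longrightarrow> RC > 0 \<longrightarrow> R_condition RO RI RC \<Omega> \<longrightarrow>
        (\<forall>f. conformal_map_onto f \<Omega> \<longrightarrow> f 0 = 0 \<longrightarrow>
             Hinf_norm (deriv f) \<le> ereal (RC * exp (2 * F RO RI RC)))) \<and>
     (\<forall>(b::complex) (\<rho>::real). cmod b < \<rho> \<longrightarrow>
        (\<forall>RO RI. R_condition RO RI \<rho> (ball b \<rho>) \<longleftrightarrow> RO = \<rho> + cmod b \<and> RI = \<rho> - cmod b) \<and>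
        (\<forall>f. conformal_map_onto f (ball b \<rho>) \<longrightarrow> f 0 = 0 \<longrightarrow>
             Hinf_norm (deriv f) = ereal (\<rho> * exp (2 * F (\<rho> + cmod b) (\<rho> - cmod b) \<rho>))))"
proof (intro conjI allI impI)
  fix RO RI RC \<Omega> f
  assume "R_condition RO RI RC \<Omega>" "conformal_map_onto f \<Omega>" "f 0 = 0"
  then show "Hinf_norm (deriv f) \<le> ereal (RC * exp (2 * F RO RI RC))"
    unfolding Hinf_norm_le_iff using deriv_conformal_map_le by blast
next
  fix b :: complex and \<rho> RO RI :: real
  assume "cmod b < \<rho>"
  then show "R_condition RO RI \<rho> (ball b \<rho>) \<longleftrightarrow> RO = \<rho> + cmod b \<and> RI = \<rho> - cmod b"
    by (rule R_condition_ball_iff)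
next
  fix b :: complex and \<rho> :: real and f
  assume b: "cmod b < \<rho>" and f: "conformal_map_onto f (ball b \<rho>)" "f 0 = 0"
  define E where "E = \<rho> * exp (2 * F (\<rho> + cmod b) (\<rho> - cmod b) \<rho>)"
  have "R_condition (\<rho> + cmod b) (\<rho> - cmod b) \<rho> (ball b \<rho>)"
    using R_condition_ball_iff[OF b] by simp
  then have "Hinf_norm (deriv f) \<le> ereal E"
    unfolding Hinf_norm_le_iff E_def using deriv_conformal_map_le f by blast
  moreover have "ereal E \<le> Hinf_norm (deriv f)"
  proof (rule ereal_le_real)
    fix M assume "Hinf_norm (deriv f) \<le> ereal M"
    then show "ereal E \<le> ereal M"
      unfolding Hinf_norm_le_iff using deriv_conformal_map_disc_ge[OF b f]
      by (simp add: E_def F_disc[OF b])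
  qed
  ultimately show "Hinf_norm (deriv f) = ereal (\<rho> * exp (2 * F (\<rho> + cmod b) (\<rho> - cmod b) \<rho>))"
    unfolding E_def by (rule antisym)
qed

end
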